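(* Let $V$ be a finite dimensional real or complex vector space endowed with a norm. Let $S$ be a subsemigroup of $GL(V)$ generated by a finite set of commuting elements. Then every coarsely dense orbit of $S$ in $V$ is dense in $V$. That is, if $v\in V$ and the orbit $S\cdot v=\{sv : s\in S\}$ is coarsely dense in $V$, then $S\cdot v$ is dense in $V$.
   Context: A subset $Y$ of a metric space $(X,d)$ is called $D$-dense in $X$ if the open balls of radius $D$ with centers at points of $Y$ cover $X$. The subset $Y$ is called coarsely dense in $X$ if there is a positive number $D$ such that $Y$ is $D$-dense in $X$. Here $V$ carries the metric induced by the norm. Density refers to the Euclidean topology. *)

theory Defs
  imports "HOL-Analysis.Analysis"
begin

text \<open>A normed real space is the type class \<open>real_normed_vector\<close>. The distribution has no class of
  normed complex spaces, so one is presented as its underlying normed real space together with a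
  complex scalar multiplication that extends the real one and is compatible with the norm.\<close>

locale complex_normed_space = vector_space smul
  for smul :: "complex \<Rightarrow> 'v::real_normed_vector \<Rightarrow> 'v" +
  assumes smul_of_real: "smul (of_real r) x = r *\<^sub>R x"
    and norm_smul: "norm (smul c x) = cmod c * norm x"

definition finite_dim :: "('k::field \<Rightarrow> 'v::ab_group_add \<Rightarrow> 'v) \<Rightarrow> bool" where
  "finite_dim smul \<longleftrightarrow> (\<exists>B. finite_dimensional_vector_space smul B)"

definition GL :: "('k::field \<Rightarrow> 'v::ab_group_add \<Rightarrow> 'v) \<Rightarrow> ('v \<Rightarrow> 'v) set" where
  "GL smul = {g. Vector_Spaces.linear smul smul g \<and> bij g}"

text \<open>Products of one or more generators: the identity map is not included unless it is such a product.\<close>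

inductive_set semigroup_generated :: "('v \<Rightarrow> 'v) set \<Rightarrow> ('v \<Rightarrow> 'v) set"
  for G :: "('v \<Rightarrow> 'v) set" where
  generator: "g \<in> G \<Longrightarrow> g \<in> semigroup_generated G"
| comp: "s \<in> semigroup_generated G \<Longrightarrow> t \<in> semigroup_generated G \<Longrightarrow> s \<circ> t \<in> semigroup_generated G"

definition orbit_of :: "('v \<Rightarrow> 'v) set \<Rightarrow> 'v \<Rightarrow> 'v set" where
  "orbit_of S v = {s v |s. s \<in> S}"

definition D_dense_in :: "real \<Rightarrow> 'a::metric_space set \<Rightarrow> 'a set \<Rightarrow> bool" where
  "D_dense_in D Y X \<longleftrightarrow> Y \<subseteq> X \<and> X \<subseteq> (\<Union>y\<in>Y. ball y D)"

definition coarsely_dense_in :: "'a::metric_space set \<Rightarrow> 'a set \<Rightarrow> bool" where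
  "coarsely_dense_in Y X \<longleftrightarrow> (\<exists>D>0. D_dense_in D Y X)"

end

theory Submission
  imports Defs
begin

text \<open>
  \<^bold>\<open>Reduction to an algebra.\<close> A coarsely dense orbit \<open>S v\<close> spans \<open>V\<close>, so evaluation at \<open>v\<close> identifies the
  commutative operator algebra generated by \<open>S\<close> with \<open>V\<close> itself. Thus \<open>V\<close> becomes a finite-dimensional
  commutative real algebra with unit \<open>u = v\<close>, and \<open>S v\<close> a finitely generated semigroup of units of it. The
  complex case is covered because complex linear maps are real linear.

  \<^bold>\<open>Quotients are dense.\<close> If \<open>s\<close> and \<open>q\<close> in the semigroup are within \<open>D\<close> of \<open>R u\<close> and of \<open>R w\<close>, then
  \<open>q / s\<close> tends to \<open>w\<close> as \<open>R \<rightarrow> \<infinity>\<close>. It therefore suffices that the closure of the semigroup contains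
  the inverses of the generators.

  \<^bold>\<open>Logarithms.\<close> The algebra has an exponential map \<open>E\<close>, a homomorphism from its additive group to its
  units that is onto a neighbourhood of \<open>u\<close>. After passing to powers, the generators are \<open>E x\<close> for finitely
  many \<open>x\<close> (lemma \<open>common_iterate_in_range_E\<close>). Let \<open>C\<close> be the subspace of directions in which \<open>E\<close> stays
  bounded. By a theorem of the alternative (\<open>stiemke_alternative\<close>) one of two things happens.

  \<^item> Some combination \<open>\<Sum> t\<^sub>x x\<close> with all \<open>t\<^sub>x \<ge> 1\<close> lies in \<open>C\<close>. By compactness there are products, in
    which every generator occurs, arbitrarily close to \<open>u\<close> (\<open>recurrence\<close>). Leaving out one generator
    approximates its inverse.

  \<^item> Some linear functional \<open>f\<close> vanishes on \<open>C\<close>, is nonnegative on all \<open>x\<close>, and is positive on one of them. Then \<open>f\<close>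
    of the logarithm is an additive function on the semigroup, and on elements of size about \<open>R\<close> near
    the ray through \<open>u\<close> it is \<open>O(ln R)\<close>; as it is a sum of finitely many kinds of nonnegative terms, it takes there only
    \<open>O((ln R)\<^sup>k)\<close> values, for \<open>k\<close> generators. But coarse density, seen at scale \<open>R\<close>, forces these values to be
    \<open>O(1 / R)\<close>-dense in an interval of fixed length. This is absurd for large \<open>R\<close>
    (\<open>no_nonnegative_functional\<close>).
\<close>

section \<open>Finite-dimensional normed spaces\<close>

lemma compact_Pi_UNIV:
  fixes K :: "'i \<Rightarrow> 'b::topological_space set"
  assumes "\<And>i. compact (K i)"
  shows "compact (PiE UNIV K)"
proof -
  have "compactin (product_topology (\<lambda>i::'i. euclidean) UNIV) (PiE UNIV K)"
    using assms by (simp add: compactin_PiE)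
  then show ?thesis
    by (simp add: euclidean_product_topology)
qed

text \<open>All norms on a finite-dimensional space are equivalent; this is the half that needs compactness. A
  norm is continuous in the coordinates and does not vanish on the unit sphere of the maximum norm,
  which is compact, so it has a positive minimum there. The rest is homogeneity. Coordinates are
  functions on the whole type that vanish off the basis, so that compactness can be read off from
  Tychonoff's theorem for the product topology on functions.\<close>

lemma norm_lincomb_lower_bound:
  fixes B :: "'v::real_normed_vector set"
  assumes B: "finite B" "independent B"
  shows "\<exists>c>0. \<forall>u. \<forall>b\<in>B. c * \<bar>u b\<bar> \<le> norm (\<Sum>b\<in>B. u b *\<^sub>R b)"
proof (cases "B = {}")
  case True
  then show ?thesis by (intro exI[of _ 1]) auto
next
  case False
  define N where "N u = norm (\<Sum>b\<in>B. u b *\<^sub>R b)" for u :: "'v \<Rightarrow> real"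
  define K where "K = PiE UNIV (\<lambda>b. if b \<in> B then {-1..1::real} else {0})"
  \<comment> \<open>The unit sphere of the maximum norm.\<close>
  define T where "T = (\<Union>b\<in>B. K \<inter> {u. \<bar>u b\<bar> = 1})"
  have contN: "continuous_on A N" for A
    unfolding N_def
    by (intro continuous_intros) (rule continuous_on_subset[OF continuous_on_product_coordinates], simp)
  have "closed {u :: 'v \<Rightarrow> real. \<bar>u b\<bar> = 1}" for b
    by (intro closed_Collect_eq continuous_intros continuous_on_product_coordinates)
  moreover have "compact K"
    unfolding K_def by (rule compact_Pi_UNIV) auto
  ultimately have compT: "compact T"
    unfolding T_def by (intro compact_UN B compact_Int_closed)
  obtain b0 where b0: "b0 \<in> B" using False by blast
  then have "(\<lambda>b. if b = b0 then 1 else 0) \<in> T"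
    unfolding T_def K_def by (auto simp: PiE_iff)
  then obtain u0 where u0: "u0 \<in> T" "\<And>u. u \<in> T \<Longrightarrow> N u0 \<le> N u"
    using continuous_attains_inf[OF compT _ contN] by blast
  have pos: "N u0 > 0"
  proof (rule ccontr)
    assume "\<not> N u0 > 0"
    then have "(\<Sum>b\<in>B. u0 b *\<^sub>R b) = 0" unfolding N_def by simp
    then have "\<forall>b\<in>B. u0 b = 0"
      using B independentD by (metis order_refl)
    moreover obtain b where "b \<in> B" "\<bar>u0 b\<bar> = 1" using u0(1) unfolding T_def by auto
    ultimately show False by auto
  qed
  have "N u0 * \<bar>u b\<bar> \<le> N u" if b: "b \<in> B" for u b
  proof -
    define m where "m = Max ((\<lambda>b. \<bar>u b\<bar>) ` B)"
    have "m \<in> (\<lambda>b. \<bar>u b\<bar>) ` B" unfolding m_def using B False by (intro Max_in) auto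
    then obtain b1 where b1: "b1 \<in> B" "m = \<bar>u b1\<bar>" by blast
    have le: "\<bar>u b'\<bar> \<le> m" if "b' \<in> B" for b' unfolding m_def using B that by auto
    show ?thesis
    proof (cases "m = 0")
      case True
      then show ?thesis using le[OF b] by (simp add: N_def)
    next
      case False
      then have m: "m > 0" using b1 by auto
      define w where "w b = (if b \<in> B then u b / m else 0)" for b
      have "u b' / m \<in> {-1..1}" if "b' \<in> B" for b'
        using le[OF that] m by (auto simp: abs_le_iff field_simps)
      then have "w \<in> K" unfolding K_def w_def by (simp add: PiE_iff)
      moreover have "\<bar>w b1\<bar> = 1" using b1 m by (simp add: w_def)
      ultimately have "w \<in> T" unfolding T_def using b1 by blast
      then have "N u0 \<le> N w" by (rule u0)
      also have "(\<Sum>b\<in>B. w b *\<^sub>R b) = (1 / m) *\<^sub>R (\<Sum>b\<in>B. u b *\<^sub>R b)"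
        by (simp add: scaleR_sum_right w_def divide_inverse mult.commute)
      then have "N w = N u / m" using m unfolding N_def by simp
      finally have "N u0 * m \<le> N u" using m by (simp add: field_simps)
      moreover have "N u0 * \<bar>u b\<bar> \<le> N u0 * m" using le[OF b] pos by simp
      ultimately show ?thesis by linarith
    qed
  qed
  then show ?thesis using pos unfolding N_def by blast
qed

text \<open>The lower bound above says exactly that the coordinate functionals are bounded. The two lemmas that
  follow are the forms in which finite dimension is used later: every linear map is continuous, and
  closed balls are compact.\<close>

lemma bounded_linear_representation:
  fixes B :: "'v::real_normed_vector set"
  assumes B: "finite B" "independent B" "span B = UNIV" and b: "b \<in> B"
  shows "bounded_linear (\<lambda>x. representation B x b)"
proof -
  obtain c where c: "c > 0" "\<And>u b. b \<in> B \<Longrightarrow> c * \<bar>u b\<bar> \<le> norm (\<Sum>b\<in>B. u b *\<^sub>R b)"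
    using norm_lincomb_lower_bound[OF B(1,2)] by blast
  show ?thesis
  proof (rule bounded_linear_intro[where K = "1 / c"])
    show "norm (representation B x b) \<le> norm x * (1 / c)" for x
      using c(2)[OF b, of "representation B x"] c(1) B
      by (simp add: real_vector.sum_representation_eq field_simps)
  qed (use B in \<open>simp_all add: real_vector.representation_add real_vector.representation_scale\<close>)
qed

lemma bounded_linear_finite_dim:
  fixes f :: "'v::real_normed_vector \<Rightarrow> 'w::real_normed_vector" and B :: "'v set"
  assumes B: "finite B" "independent B" "span B = UNIV" and f: "linear f"
  shows "bounded_linear f"
proof -
  have "f = (\<lambda>x. \<Sum>b\<in>B. representation B x b *\<^sub>R f b)"
  proof
    fix x
    have "f x = f (\<Sum>b\<in>B. representation B x b *\<^sub>R b)"
      using B by (simp add: real_vector.sum_representation_eq)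
    also have "\<dots> = (\<Sum>b\<in>B. representation B x b *\<^sub>R f b)"
      using f by (simp add: linear_sum linear_cmul)
    finally show "f x = (\<Sum>b\<in>B. representation B x b *\<^sub>R f b)" .
  qed
  moreover have "bounded_linear (\<lambda>x. \<Sum>b\<in>B. representation B x b *\<^sub>R f b)"
    by (intro bounded_linear_sum bounded_linear_scaleR_const bounded_linear_representation B)
  ultimately show ?thesis by simp
qed

lemma compact_cball_finite_dim:
  fixes B :: "'v::real_normed_vector set"
  assumes B: "finite B" "independent B" "span B = UNIV"
  shows "compact (cball (0::'v) r)"
proof -
  obtain c where c: "c > 0" "\<And>u b. b \<in> B \<Longrightarrow> c * \<bar>u b\<bar> \<le> norm (\<Sum>b\<in>B. u b *\<^sub>R b)"
    using norm_lincomb_lower_bound[OF B(1,2)] by blast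
  define K where "K = PiE UNIV (\<lambda>b. if b \<in> B then {-(r/c)..r/c} else {0})"
  define F where "F u = (\<Sum>b\<in>B. u b *\<^sub>R b)" for u :: "'v \<Rightarrow> real"
  have "continuous_on K F"
    unfolding F_def
    by (intro continuous_intros) (rule continuous_on_subset[OF continuous_on_product_coordinates], simp)
  moreover have "compact K"
    unfolding K_def by (rule compact_Pi_UNIV) auto
  ultimately have "compact (F ` K)" by (rule compact_continuous_image)
  moreover have "cball 0 r \<subseteq> F ` K"
  proof
    fix x :: 'v assume x: "x \<in> cball 0 r"
    have eq: "F (representation B x) = x"
      unfolding F_def using B by (simp add: real_vector.sum_representation_eq)
    have "\<bar>representation B x b\<bar> \<le> r / c" if "b \<in> B" for b
      using c(2)[OF that, of "representation B x"] eq x c(1) unfolding F_def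
      by (simp add: field_simps)
    moreover have "representation B x b = 0" if "b \<notin> B" for b
      using that real_vector.representation_ne_zero by blast
    ultimately have "representation B x \<in> K"
      unfolding K_def by (auto simp: PiE_iff abs_le_iff minus_le_iff)
    then show "x \<in> F ` K" using eq by (metis image_eqI)
  qed
  ultimately show ?thesis
    by (metis closed_cball compact_Int_closed inf.absorb_iff2)
qed

text \<open>A basis of \<open>C\<close> stays independent when \<open>x\<close> is added, and on a basis the values are free.\<close>

lemma exists_linear_functional:
  fixes C :: "'v::real_vector set"
  assumes C: "subspace C" and x: "x \<notin> C"
  shows "\<exists>f::'v \<Rightarrow> real. linear f \<and> (\<forall>y\<in>C. f y = 0) \<and> f x = 1"
proof -
  obtain B where B: "B \<subseteq> C" "independent B" "C \<subseteq> span B"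
    by (rule real_vector.maximal_independent_subset)
  have spB: "span B = C" using B C by (metis span_minimal subset_antisym)
  have "independent (insert x B)" using B spB x by (simp add: independent_insert)
  then obtain f :: "'v \<Rightarrow> real" where f: "linear f" "\<forall>y\<in>insert x B. f y = (if y = x then 1 else 0)"
    using linear_independent_extend[of "insert x B" "\<lambda>y. if y = x then 1 else 0"] by metis
  have "f y = 0" if "y \<in> C" for y
  proof -
    have "\<And>b. b \<in> B \<Longrightarrow> f b = 0" using f B x by auto
    then show ?thesis using that spB f(1) linear_eq_0_on_span by metis
  qed
  then show ?thesis using f by auto
qed

section \<open>Nonnegative combinations: an alternative and a count\<close>

text \<open>A generator with positive value \<open>\<phi> x \<ge> \<delta>\<close> can occur at most \<open>M / \<delta>\<close> times in a sum that is at most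
  \<open>M\<close>, and generators with value \<open>0\<close> do not change the sum. So the number of values up to \<open>M\<close> grows
  only polynomially in \<open>M\<close>, with the number of generators as exponent.\<close>

lemma card_small_combinations:
  fixes \<phi> :: "'a \<Rightarrow> real"
  assumes X: "finite X" and \<phi>: "\<And>x. x \<in> X \<Longrightarrow> 0 \<le> \<phi> x"
    and \<delta>: "0 < \<delta>" "\<And>x. x \<in> X \<Longrightarrow> 0 < \<phi> x \<Longrightarrow> \<delta> \<le> \<phi> x" and M: "0 \<le> M"
  defines "V \<equiv> {s. s \<le> M \<and> (\<exists>n::'a \<Rightarrow> nat. s = (\<Sum>x\<in>X. real (n x) * \<phi> x))}"
  shows "finite V \<and> real (card V) \<le> (M / \<delta> + 1) ^ card X"
proof -
  define P where "P = {x \<in> X. 0 < \<phi> x}"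
  define m where "m = nat \<lfloor>M / \<delta>\<rfloor>"
  define F where "F n = (\<Sum>x\<in>P. real (n x) * \<phi> x)" for n :: "'a \<Rightarrow> nat"
  have P: "finite P" "P \<subseteq> X" unfolding P_def using X by auto
  have drop0: "(\<Sum>x\<in>X. real (n x) * \<phi> x) = F n" for n
    unfolding F_def by (rule sum.mono_neutral_right) (use X \<phi> in \<open>force simp: P_def\<close>)+
  have "V \<subseteq> F ` (PiE P (\<lambda>_. {..m}))"
  proof
    fix s assume "s \<in> V"
    then obtain n where n: "s = F n" "F n \<le> M" unfolding V_def drop0 by auto
    have "n x \<le> m" if x: "x \<in> P" for x
    proof -
      have "real (n x) * \<delta> \<le> real (n x) * \<phi> x"
        using x \<delta>(2) unfolding P_def by (intro mult_left_mono) auto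
      also have "\<dots> \<le> F n"
        unfolding F_def using P x by (intro member_le_sum) (auto simp: P_def)
      finally have "real (n x) \<le> M / \<delta>" using n(2) \<delta>(1) by (simp add: field_simps)
      then show ?thesis unfolding m_def by (simp add: le_nat_floor)
    qed
    then have "restrict n P \<in> PiE P (\<lambda>_. {..m})" by auto
    moreover have "F (restrict n P) = F n" unfolding F_def by simp
    ultimately show "s \<in> F ` (PiE P (\<lambda>_. {..m}))" using n(1) by (metis image_eqI)
  qed
  moreover have fin: "finite (PiE P (\<lambda>_. {..m}))" using P by (intro finite_PiE) auto
  ultimately have fV: "finite V" and cV: "card V \<le> card (PiE P (\<lambda>_. {..m}))"
    by (blast intro: finite_subset, metis surj_card_le)
  have "real (card (PiE P (\<lambda>_. {..m}))) = (real m + 1) ^ card P"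
    using P by (simp add: card_PiE add.commute)
  also have "\<dots> \<le> (M / \<delta> + 1) ^ card P"
    using M \<delta>(1) unfolding m_def by (intro power_mono) auto
  also have "\<dots> \<le> (M / \<delta> + 1) ^ card X"
    using M \<delta>(1) X P by (intro power_increasing card_mono) auto
  finally show ?thesis using fV cV by linarith
qed

text \<open>This is where finite generation enters. If the values were \<open>c / R\<close>-dense in an interval of fixed
  length at height about \<open>\<alpha> ln R\<close>, there would be at least a constant times \<open>R\<close> of them, whereas
  only polynomially many in \<open>ln R\<close> are available.\<close>

lemma combinations_not_log_dense:
  fixes \<phi> :: "'a \<Rightarrow> real" and \<alpha> \<beta> c R0 :: real
  assumes X: "finite X" and \<phi>: "\<And>x. x \<in> X \<Longrightarrow> 0 \<le> \<phi> x" and \<beta>: "0 < \<beta>" and c: "0 < c"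
    and dense: "\<And>R \<tau>. R0 \<le> R \<Longrightarrow> 0 \<le> \<tau> \<Longrightarrow> \<tau> \<le> 1 \<Longrightarrow>
      \<exists>n::'a \<Rightarrow> nat. \<bar>(\<Sum>x\<in>X. real (n x) * \<phi> x) - (\<alpha> * ln R + \<beta> * \<tau>)\<bar> \<le> c / R"
  shows False
proof -
  \<comment> \<open>The 1 only keeps the minimum defined when no value is positive.\<close>
  define \<delta> where "\<delta> = Min (insert 1 (\<phi> ` {x \<in> X. 0 < \<phi> x}))"
  have \<delta>: "0 < \<delta>" "\<And>x. x \<in> X \<Longrightarrow> 0 < \<phi> x \<Longrightarrow> \<delta> \<le> \<phi> x"
    unfolding \<delta>_def using X by auto
  define k where "k = card X"
  define A where "A = \<beta> / (3 * c)"
  define Q where "Q = ((\<bar>\<alpha>\<bar> + \<beta> + c) / \<delta> + 1) ^ k"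
  have A: "0 < A" unfolding A_def using \<beta> c by simp
  \<comment> \<open>With \<open>R = exp \<rho>\<close>, the left side counts the values that are needed, the right side those available.\<close>
  have main: "A * exp \<rho> - 1 \<le> Q * \<rho> ^ k" if \<rho>: "1 \<le> \<rho>" "R0 \<le> exp \<rho>" for \<rho>
  proof -
    define R where "R = exp \<rho>"
    define N where "N = nat \<lfloor>A * R\<rfloor>"
    define M where "M = (\<bar>\<alpha>\<bar> + \<beta> + c) * \<rho>"
    have R: "1 \<le> R" unfolding R_def using \<rho> by simp
    have N: "real N \<le> A * R" "A * R - 1 \<le> real N"
      unfolding N_def using A R by (auto intro: of_nat_floor)
    define V where "V = {s. s \<le> M \<and> (\<exists>n::'a \<Rightarrow> nat. s = (\<Sum>x\<in>X. real (n x) * \<phi> x))}"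
    have V: "finite V" "real (card V) \<le> (M / \<delta> + 1) ^ k"
      unfolding V_def k_def using card_small_combinations[OF X \<phi> \<delta>, where M = M] \<beta> c \<rho> by (simp_all add: M_def)
    have "\<exists>s\<in>V. \<bar>s - (\<alpha> * \<rho> + \<beta> * (real l / real N))\<bar> \<le> c / R" if l: "l < N" for l
    proof -
      have t: "0 \<le> real l / real N" "real l / real N \<le> 1" using l by auto
      obtain n :: "'a \<Rightarrow> nat" where
        n: "\<bar>(\<Sum>x\<in>X. real (n x) * \<phi> x) - (\<alpha> * \<rho> + \<beta> * (real l / real N))\<bar> \<le> c / R"
        using dense[of R, OF _ t] \<rho>(2) unfolding R_def by auto
      have "\<alpha> * \<rho> \<le> \<bar>\<alpha>\<bar> * \<rho>" using \<rho> by (intro mult_right_mono) auto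
      moreover have "\<beta> * (real l / real N) \<le> \<beta> * \<rho>"
        using t \<rho>(1) \<beta> by (intro mult_left_mono) auto
      moreover have "c / R \<le> c * \<rho>"
      proof -
        have "c / R \<le> c / 1" using R c by (intro divide_left_mono) auto
        moreover have "c * 1 \<le> c * \<rho>" using c \<rho>(1) by (intro mult_left_mono) auto
        ultimately show ?thesis by simp
      qed
      ultimately have "(\<Sum>x\<in>X. real (n x) * \<phi> x) \<le> M"
        using n unfolding M_def distrib_right by linarith
      then show ?thesis using n unfolding V_def by blast
    qed
    then obtain s where s: "\<And>l. l < N \<Longrightarrow> s l \<in> V"
      "\<And>l. l < N \<Longrightarrow> \<bar>s l - (\<alpha> * \<rho> + \<beta> * (real l / real N))\<bar> \<le> c / R" by metis
    \<comment> \<open>The targets are \<open>\<beta> / N \<ge> 3 c / R\<close> apart, so points within \<open>c / R\<close> of them are distinct.\<close>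
    have "inj_on s {..<N}"
    proof (rule inj_onI, rule ccontr)
      fix l l' assume l: "l \<in> {..<N}" "l' \<in> {..<N}" "s l = s l'" "l \<noteq> l'"
      have "\<bar>\<beta> * (real l / real N) - \<beta> * (real l' / real N)\<bar> \<le> 2 * c / R"
        using s(2)[of l] s(2)[of l'] l by auto
      moreover have "\<bar>\<beta> * (real l / real N) - \<beta> * (real l' / real N)\<bar> = \<beta> / real N * \<bar>real l - real l'\<bar>"
        using \<beta> by (simp add: abs_mult flip: right_diff_distrib diff_divide_distrib)
      moreover have "1 \<le> \<bar>real l - real l'\<bar>" using l(4) by linarith
      ultimately have "\<beta> / real N * 1 \<le> 2 * c / R"
        using \<beta> mult_left_mono[of 1 "\<bar>real l - real l'\<bar>" "\<beta> / real N"] by simp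
      moreover have N0: "0 < real N" using l by auto
      ultimately have "\<beta> * R \<le> 2 * c * real N" using R by (simp add: field_simps)
      also have "\<dots> \<le> 2 * c * (A * R)" using N(1) c by (intro mult_left_mono) auto
      also have "\<dots> = 2 / 3 * \<beta> * R" unfolding A_def using c by simp
      finally show False using \<beta> R by simp
    qed
    then have "N \<le> card V"
      using card_inj_on_le[of s "{..<N}" V] s(1) V(1) by auto
    then have "A * R - 1 \<le> (M / \<delta> + 1) ^ k" using N(2) V(2) by linarith
    also have "\<dots> \<le> (((\<bar>\<alpha>\<bar> + \<beta> + c) / \<delta> + 1) * \<rho>) ^ k"
      using \<rho>(1) \<beta> c \<delta>(1) unfolding M_def by (intro power_mono) (auto simp: algebra_simps)
    finally show ?thesis unfolding R_def Q_def power_mult_distrib .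
  qed
  have "((\<lambda>\<rho>. Q * (\<rho> ^ k / exp \<rho>)) \<longlongrightarrow> Q * 0) at_top"
    by (intro tendsto_intros tendsto_power_div_exp_0)
  then have "eventually (\<lambda>\<rho>. Q * (\<rho> ^ k / exp \<rho>) < A / 2) at_top"
    by (rule order_tendstoD) (use A in simp)
  moreover have "eventually (\<lambda>\<rho>::real. max (2 / A) R0 < exp \<rho>) at_top"
    using exp_at_top unfolding filterlim_at_top_dense by (rule spec)
  ultimately have "eventually (\<lambda>\<rho>::real. Q * (\<rho> ^ k / exp \<rho>) < A / 2 \<and> max (2 / A) R0 < exp \<rho> \<and> 1 \<le> \<rho>) at_top"
    by (intro eventually_conj eventually_ge_at_top)
  then obtain \<rho> :: real where \<rho>: "Q * (\<rho> ^ k / exp \<rho>) < A / 2" "2 / A < exp \<rho>" "R0 < exp \<rho>" "1 \<le> \<rho>"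
    using eventually_happens'[OF trivial_limit_at_top_linorder] by fastforce
  have "Q * \<rho> ^ k < A / 2 * exp \<rho>" using \<rho>(1) by (simp add: field_simps)
  moreover have "1 < A / 2 * exp \<rho>" using \<rho>(2) A by (simp add: field_simps)
  ultimately show False using main[OF \<rho>(4)] \<rho>(3) by (simp add: field_simps)
qed

text \<open>Stiemke's theorem of the alternative relative to a subspace \<open>C\<close>. The proof is by induction on the
  vectors. Let \<open>y\<close> be the new one. If the old vectors have a functional \<open>f\<close> with \<open>f y \<ge> 0\<close>, it still
  works; if \<open>f y < 0\<close>, the alternative for \<open>C\<close> enlarged by \<open>y\<close> either gives a functional vanishing at
  \<open>y\<close> or a relation in which \<open>y\<close> must, by evaluating \<open>f\<close>, have a positive coefficient. If the old
  vectors have a positive relation, then either \<open>y\<close> is independent of them and of \<open>C\<close>, and a functional sees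
  only \<open>y\<close>, or \<open>-y\<close> is a combination whose coefficients become positive after adding a large
  multiple of that relation.\<close>

lemma stiemke_alternative:
  fixes X C :: "'v::real_vector set"
  assumes "finite X" "subspace C"
  shows "(\<exists>t. (\<forall>x\<in>X. 1 \<le> t x) \<and> (\<Sum>x\<in>X. t x *\<^sub>R x) \<in> C) \<or>
    (\<exists>f. linear f \<and> (\<forall>y\<in>C. f y = 0) \<and> (\<forall>x\<in>X. 0 \<le> f x) \<and> (\<exists>x\<in>X. 0 < (f x :: real)))"
    (is "?a X C \<or> ?b X C")
  using assms
proof (induction X arbitrary: C rule: finite_induct)
  case empty
  then show ?case by (simp add: subspace_0)
next
  case (insert y X)
  note sub = \<open>subspace C\<close>
  have spC: "span C = C" using sub by (simp add: span_eq_iff)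
  have sum_upd: "(\<Sum>x\<in>insert y X. (if x = y then k else t x) *\<^sub>R x) = k *\<^sub>R y + (\<Sum>x\<in>X. t x *\<^sub>R x)" for k t
  proof -
    have "(\<Sum>x\<in>X. (if x = y then k else t x) *\<^sub>R x) = (\<Sum>x\<in>X. t x *\<^sub>R x)"
      using insert.hyps by (intro sum.cong) auto
    then show ?thesis using insert.hyps by simp
  qed
  from insert.IH[OF sub] show ?case
  proof
    assume "?b X C"
    then obtain f :: "'v \<Rightarrow> real" where f: "linear f" "\<forall>y\<in>C. f y = 0" "\<forall>x\<in>X. 0 \<le> f x" "\<exists>x\<in>X. 0 < f x"
      by blast
    show ?thesis
    proof (cases "0 \<le> f y")
      case True
      then show ?thesis using f by blast
    next
      case False
      have "subspace (span (insert y C))" by simp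
      from insert.IH[OF this] show ?thesis
      proof
        assume "?b X (span (insert y C))"
        then obtain g :: "'v \<Rightarrow> real" where g: "linear g" "\<forall>z\<in>span (insert y C). g z = 0"
          "\<forall>x\<in>X. 0 \<le> g x" "\<exists>x\<in>X. 0 < g x" by blast
        have "g z = 0" if "z \<in> insert y C" for z using g(2) that span_base by blast
        then have "?b (insert y X) C" using g by (intro exI[of _ g]) auto
        then show ?thesis ..
      next
        assume "?a X (span (insert y C))"
        then obtain t where t: "\<forall>x\<in>X. 1 \<le> t x" "(\<Sum>x\<in>X. t x *\<^sub>R x) \<in> span (insert y C)" by blast
        then obtain k where k: "(\<Sum>x\<in>X. t x *\<^sub>R x) - k *\<^sub>R y \<in> C"
          using span_breakdown_eq[of _ y C] spC by auto
        have "f ((\<Sum>x\<in>X. t x *\<^sub>R x) - k *\<^sub>R y) = 0" using f(2) k by blast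
        then have eq: "(\<Sum>x\<in>X. t x * f x) = k * f y"
          using f(1) by (simp add: linear_diff linear_sum linear_cmul)
        have "0 < (\<Sum>x\<in>X. t x * f x)"
        proof -
          obtain x where x: "x \<in> X" "0 < f x" using f(4) by blast
          have "0 < t x * f x" using x t by (metis less_le_trans mult_pos_pos zero_less_one)
          also have "\<dots> \<le> (\<Sum>x\<in>X. t x * f x)"
            using x t f(3) insert.hyps
            by (intro member_le_sum) (auto intro!: mult_nonneg_nonneg intro: order_trans[of 0 1])
          finally show ?thesis .
        qed
        then have k0: "k < 0" using eq False by (smt (verit) mult_nonneg_nonpos)
        define s where "s = max 1 (1 / (- k))"
        have s: "1 \<le> s" "1 \<le> s * (- k)"
          using k0 mult_right_mono[of "1 / (- k)" s "- k"] unfolding s_def by auto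
        have "s *\<^sub>R ((\<Sum>x\<in>X. t x *\<^sub>R x) - k *\<^sub>R y) \<in> C" using k sub by (simp add: subspace_scale)
        moreover have "s *\<^sub>R ((\<Sum>x\<in>X. t x *\<^sub>R x) - k *\<^sub>R y) = (s * (- k)) *\<^sub>R y + (\<Sum>x\<in>X. (s * t x) *\<^sub>R x)"
          by (simp add: scaleR_diff_right scaleR_sum_right)
        moreover have "1 \<le> s * t x" if "x \<in> X" for x
          using mult_mono[of 1 s 1 "t x"] s(1) t that by auto
        ultimately have "?a (insert y X) C"
          using s(2) by (intro exI[of _ "\<lambda>x. if x = y then s * (- k) else s * t x"]) (simp add: sum_upd)
        then show ?thesis ..
      qed
    qed
  next
    assume "?a X C"
    then obtain t where t: "\<forall>x\<in>X. 1 \<le> t x" "(\<Sum>x\<in>X. t x *\<^sub>R x) \<in> C" by blast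
    show ?thesis
    proof (cases "y \<in> span (C \<union> X)")
      case False
      then obtain f :: "'v \<Rightarrow> real" where f: "linear f" "\<forall>z\<in>span (C \<union> X). f z = 0" "f y = 1"
        using exists_linear_functional[of "span (C \<union> X)" y] by auto
      have "f z = 0" if "z \<in> C \<union> X" for z using f(2) that span_base by blast
      then have "?b (insert y X) C" using f by (intro exI[of _ f]) auto
      then show ?thesis ..
    next
      case True
      then obtain c d where cd: "y = c + d" "c \<in> span C" "d \<in> span X" unfolding span_Un by auto
      then obtain a where a: "d = (\<Sum>x\<in>X. a x *\<^sub>R x)" using span_finite[OF insert.hyps(1)] by auto
      define N where "N = 1 + (\<Sum>x\<in>X. \<bar>a x\<bar>)"
      have N1: "1 \<le> N" unfolding N_def by (simp add: sum_nonneg)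
      have ge: "1 \<le> N * t x - a x" if x: "x \<in> X" for x
      proof -
        have "\<bar>a x\<bar> \<le> N - 1"
          using member_le_sum[OF x, of "\<lambda>x. \<bar>a x\<bar>"] insert.hyps unfolding N_def by simp
        moreover have "N * 1 \<le> N * t x" using N1 t x by (intro mult_left_mono) auto
        ultimately show ?thesis by linarith
      qed
      have "1 *\<^sub>R y + (\<Sum>x\<in>X. (N * t x - a x) *\<^sub>R x) = c + N *\<^sub>R (\<Sum>x\<in>X. t x *\<^sub>R x)"
        unfolding cd(1) a by (simp add: scaleR_left_diff_distrib sum_subtractf scaleR_sum_right)
      also have "\<dots> \<in> C" using cd(2) spC t(2) sub by (simp add: subspace_add subspace_scale)
      finally have "?a (insert y X) C"
        using ge by (intro exI[of _ "\<lambda>x. if x = y then 1 else N * t x - a x"]) (simp add: sum_upd)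
      then show ?thesis ..
    qed
  qed
qed

section \<open>The exponential map of a finite-dimensional commutative algebra\<close>

lemma one_plus_power_le_exp:
  fixes s :: real
  assumes "0 \<le> s"
  shows "(1 + s) ^ m \<le> exp (real m * s)"
proof -
  have "(1 + s) ^ m \<le> exp s ^ m" using assms by (intro power_mono) auto
  then show ?thesis by (simp add: exp_of_nat_mult)
qed

text \<open>Two uses are made of this below: all \<open>n\<close> together give the Cauchy property, and \<open>n = 0\<close> compares the
  limit with the first term.\<close>

lemma geometric_steps_bound:
  fixes X :: "nat \<Rightarrow> 'v::real_normed_vector"
  assumes "\<And>n. norm (X (Suc n) - X n) \<le> c / 2 ^ n" and c: "0 \<le> c"
  shows "norm (X (n + k) - X n) \<le> 2 * c / 2 ^ n"
proof -
  have "norm (X (n + k) - X n) \<le> 2 * c / 2 ^ n * (1 - 1 / 2 ^ k)"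
  proof (induction k)
    case (Suc k)
    have "norm (X (n + Suc k) - X n) \<le> norm (X (Suc (n + k)) - X (n + k)) + norm (X (n + k) - X n)"
      using norm_triangle_ineq[of "X (Suc (n + k)) - X (n + k)" "X (n + k) - X n"] by simp
    also have "\<dots> \<le> c / 2 ^ (n + k) + 2 * c / 2 ^ n * (1 - 1 / 2 ^ k)"
      by (intro add_mono assms Suc)
    also have "\<dots> = 2 * c / 2 ^ n * (1 - 1 / 2 ^ Suc k)"
      by (simp add: field_simps power_add)
    finally show ?case .
  qed simp
  also have "\<dots> \<le> 2 * c / 2 ^ n * 1"
    using c by (intro mult_left_mono) auto
  finally show ?thesis by simp
qed

text \<open>A finite-dimensional commutative algebra whose underlying space carries an arbitrary norm. The
  product is a parameter because the algebras of interest live on the given space and depend on the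
  semigroup and on the vector whose orbit is studied; \<open>B\<close> is any basis.\<close>

locale fd_comm_algebra =
  fixes mult :: "'v::real_normed_vector \<Rightarrow> 'v \<Rightarrow> 'v" (infixl "\<star>" 70) and u :: 'v and B :: "'v set"
  assumes bilin: "bounded_bilinear (\<star>)"
    and assoc: "(x \<star> y) \<star> z = x \<star> (y \<star> z)"
    and commute: "x \<star> y = y \<star> x"
    and unit: "u \<star> x = x"
    and B: "finite B" "independent B" "span B = UNIV"
begin

sublocale m: bounded_bilinear "(\<star>)" by (rule bilin)

lemma left_commute: "x \<star> (y \<star> z) = y \<star> (x \<star> z)"
  by (metis assoc commute)

lemmas ac = assoc commute left_commute

lemma unit_right: "x \<star> u = x" by (metis unit commute)

lemmas distribs = m.add_left m.add_right m.diff_left m.diff_right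

definition K :: real where
  "K = (SOME K. 1 \<le> K \<and> (\<forall>a b. norm (a \<star> b) \<le> K * norm a * norm b))"

lemma K: "1 \<le> K" "norm (a \<star> b) \<le> K * norm a * norm b"
proof -
  obtain k where k: "k > 0" "\<And>a b. norm (a \<star> b) \<le> norm a * norm b * k"
    using m.pos_bounded by blast
  have "norm (a \<star> b) \<le> max 1 k * norm a * norm b" for a b
  proof -
    have "norm a * norm b * k \<le> norm a * norm b * max 1 k"
      by (intro mult_left_mono) auto
    then show ?thesis using k(2)[of a b] by (simp add: mult.commute mult.left_commute)
  qed
  then have "\<exists>K. 1 \<le> K \<and> (\<forall>a b. norm (a \<star> b) \<le> K * norm a * norm b)"
    by (intro exI[of _ "max 1 k"]) auto
  then have "1 \<le> K \<and> (\<forall>a b. norm (a \<star> b) \<le> K * norm a * norm b)"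
    unfolding K_def by (rule someI_ex)
  then show "1 \<le> K" "norm (a \<star> b) \<le> K * norm a * norm b" by auto
qed

lemma Cauchy_convergent_fd:
  fixes X :: "nat \<Rightarrow> 'v"
  assumes "Cauchy X"
  shows "convergent X"
proof -
  obtain r where r: "\<And>n. norm (X n) \<le> r"
    using Cauchy_Bseq[OF assms] by (auto simp: Bseq_def)
  have "complete (cball (0::'v) r)"
    by (intro compact_imp_complete compact_cball_finite_dim[OF B])
  then show ?thesis
    using assms r unfolding complete_def convergent_def by (metis dist_0_norm mem_cball)
qed

definition sq :: "'v \<Rightarrow> 'v" where "sq a = a \<star> a"

lemma sq_iter_mult: "(sq ^^ n) (a \<star> b) = (sq ^^ n) a \<star> (sq ^^ n) b"
  by (induction n) (simp_all add: sq_def ac)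

lemma sq_iter_unit: "(sq ^^ n) u = u"
  by (induction n) (simp_all add: sq_def unit)

lemma sq_iter_scaleR: "(sq ^^ n) (t *\<^sub>R a) = (t ^ 2 ^ n) *\<^sub>R (sq ^^ n) a"
  by (induction n) (simp_all add: sq_def m.scaleR_left m.scaleR_right power_mult power2_eq_square mult.commute
      flip: power_add mult_2)

text \<open>Stability of repeated squaring: \<open>a\<^sup>2 - b\<^sup>2 = (a + b) (a - b)\<close>, and \<open>\<rho>\<close> bounds multiplication by \<open>a\<close>
  and by \<open>b\<close>.\<close>

lemma sq_iter_diff:
  assumes "1 \<le> \<rho>" "\<And>z. norm (a \<star> z) \<le> \<rho> * norm z" "\<And>z. norm (b \<star> z) \<le> \<rho> * norm z"
  shows "norm ((sq ^^ n) a - (sq ^^ n) b) \<le> 2 ^ n * \<rho> ^ 2 ^ n * norm (a - b)"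
proof -
  \<comment> \<open>The exponent \<open>2 ^ n - 1 = 1 + 2 + \<dots> + 2 ^ (n - 1)\<close> is the one that the induction reproduces.\<close>
  have "norm ((sq ^^ n) a - (sq ^^ n) b) \<le> 2 ^ n * \<rho> ^ (2 ^ n - 1) * norm (a - b)"
    using assms
  proof (induction n arbitrary: a b \<rho>)
    case (Suc n)
    have sq: "norm (sq c \<star> z) \<le> \<rho>\<^sup>2 * norm z" if "\<And>z. norm (c \<star> z) \<le> \<rho> * norm z" for c z
    proof -
      have "norm (sq c \<star> z) \<le> \<rho> * norm (c \<star> z)" unfolding sq_def assoc by (rule that)
      also have "\<dots> \<le> \<rho> * (\<rho> * norm z)" using that Suc(2) by (intro mult_left_mono) auto
      finally show ?thesis by (simp add: power2_eq_square mult.assoc)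
    qed
    have "sq a - sq b = a \<star> (a - b) + b \<star> (a - b)"
      unfolding sq_def by (simp add: distribs commute)
    then have d: "norm (sq a - sq b) \<le> 2 * \<rho> * norm (a - b)"
      using norm_triangle_ineq[of "a \<star> (a - b)" "b \<star> (a - b)"] Suc(3)[of "a - b"] Suc(4)[of "a - b"]
      by simp
    have "norm ((sq ^^ Suc n) a - (sq ^^ Suc n) b) = norm ((sq ^^ n) (sq a) - (sq ^^ n) (sq b))"
      by (simp add: funpow_swap1)
    also have "\<dots> \<le> 2 ^ n * (\<rho>\<^sup>2) ^ (2 ^ n - 1) * norm (sq a - sq b)"
      using Suc(2) sq[OF Suc(3)] sq[OF Suc(4)] by (intro Suc.IH) auto
    also have "\<dots> \<le> 2 ^ n * (\<rho>\<^sup>2) ^ (2 ^ n - 1) * (2 * \<rho> * norm (a - b))"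
      using d by (intro mult_left_mono) auto
    also have "\<dots> = 2 ^ Suc n * \<rho> ^ (Suc (2 * (2 ^ n - 1))) * norm (a - b)"
      by (simp add: power_mult)
    also have "Suc (2 * (2 ^ n - 1)) = 2 ^ Suc n - 1"
      using one_le_power[of "2::nat" n] unfolding power_Suc by linarith
    finally show ?case .
  qed simp
  also have "\<dots> \<le> 2 ^ n * \<rho> ^ 2 ^ n * norm (a - b)"
    using assms(1) by (intro mult_right_mono mult_left_mono power_increasing) auto
  finally show ?thesis .
qed

lemma mult_unit_plus_bound: "norm ((u + y) \<star> z) \<le> (1 + K * norm y) * norm z"
proof -
  have "norm ((u + y) \<star> z) \<le> norm z + norm (y \<star> z)"
    by (simp add: distribs unit norm_triangle_ineq)
  then show ?thesis using K(2)[of y z] by (simp add: distrib_right)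
qed

text \<open>The two arguments differ by the product of \<open>x / 2\<^sup>n\<close> and \<open>y / 2\<^sup>n\<close>, hence by \<open>O(1 / 4\<^sup>n)\<close>, while squaring \<open>n\<close> times
  magnifies differences only by \<open>O(2\<^sup>n)\<close>. With \<open>y = x\<close> this makes the approximations to the
  exponential converge; for general \<open>x\<close> and \<open>y\<close> it makes the limit a homomorphism.\<close>

lemma sq_iter_compare:
  "norm ((sq ^^ n) ((u + x /\<^sub>R 2 ^ n) \<star> (u + y /\<^sub>R 2 ^ n)) - (sq ^^ n) (u + (x + y) /\<^sub>R 2 ^ n))
    \<le> exp (K * (norm x + norm y)) * K * norm x * norm y / 2 ^ n"
proof -
  define x' y' where "x' = x /\<^sub>R 2 ^ n" and "y' = y /\<^sub>R 2 ^ n"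
  define \<rho> where "\<rho> = (1 + K * norm x') * (1 + K * norm y')"
  have K0: "0 \<le> K" using K(1) by simp
  have nx: "norm x' = norm x / 2 ^ n" and ny: "norm y' = norm y / 2 ^ n"
    unfolding x'_def y'_def by (simp_all add: divide_inverse)
  have nn: "0 \<le> K * norm x'" "0 \<le> K * norm y'" "0 \<le> K * norm x' * (K * norm y')"
    using K0 by simp_all
  have \<rho>2: "1 + K * norm (x' + y') \<le> \<rho>"
  proof -
    have "\<rho> = 1 + K * norm x' + K * norm y' + K * norm x' * (K * norm y')"
      unfolding \<rho>_def by (simp add: algebra_simps)
    moreover have "K * norm (x' + y') \<le> K * norm x' + K * norm y'"
      using mult_left_mono[OF norm_triangle_ineq[of x' y'] K0] by (simp add: distrib_left)
    ultimately show ?thesis using nn(3) by linarith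
  qed
  have \<rho>1: "1 \<le> \<rho>" using \<rho>2 mult_nonneg_nonneg[OF K0 norm_ge_zero[of "x' + y'"]] by linarith
  have b1: "norm ((u + x') \<star> (u + y') \<star> z) \<le> \<rho> * norm z" for z
  proof -
    have "norm ((u + x') \<star> (u + y') \<star> z) \<le> (1 + K * norm x') * norm ((u + y') \<star> z)"
      unfolding assoc by (rule mult_unit_plus_bound)
    also have "\<dots> \<le> (1 + K * norm x') * ((1 + K * norm y') * norm z)"
      using nn by (intro mult_left_mono mult_unit_plus_bound) auto
    finally show ?thesis unfolding \<rho>_def by (simp add: mult.assoc)
  qed
  have b2: "norm ((u + (x' + y')) \<star> z) \<le> \<rho> * norm z" for z
    using mult_unit_plus_bound[of "x' + y'" z] mult_right_mono[OF \<rho>2 norm_ge_zero[of z]] by linarith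
  have "(u + x') \<star> (u + y') - (u + (x' + y')) = x' \<star> y'"
    by (simp add: distribs unit unit_right)
  then have "norm ((sq ^^ n) ((u + x') \<star> (u + y')) - (sq ^^ n) (u + (x' + y')))
      \<le> 2 ^ n * \<rho> ^ 2 ^ n * norm (x' \<star> y')"
    using sq_iter_diff[OF \<rho>1 b1 b2, of n] by simp
  also have "\<dots> \<le> 2 ^ n * exp (K * (norm x + norm y)) * (K * norm x' * norm y')"
  proof (intro mult_mono K(2))
    have "\<rho> ^ 2 ^ n \<le> exp (real (2 ^ n) * (K * norm x')) * exp (real (2 ^ n) * (K * norm y'))"
      unfolding \<rho>_def power_mult_distrib using nn
      by (intro mult_mono one_plus_power_le_exp) auto
    also have "\<dots> = exp (K * (norm x + norm y))"
      by (simp add: nx ny distrib_left flip: exp_add)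
    finally show "\<rho> ^ 2 ^ n \<le> exp (K * (norm x + norm y))" .
  qed (use \<rho>1 in auto)
  also have "\<dots> = exp (K * (norm x + norm y)) * K * norm x * norm y / 2 ^ n"
    by (simp add: nx ny)
  finally show ?thesis
    unfolding x'_def y'_def by (simp add: scaleR_add_right)
qed

text \<open>The exponential \<open>E\<close> of the algebra is built as the limit of \<open>(u + x / 2\<^sup>n)\<close> raised to the power \<open>2\<^sup>n\<close>.
  The first approximation is \<open>u + x\<close> itself, so the bound on the sum of the steps is at once the second-order
  estimate \<open>E_near\<close>.\<close>

definition approx_E :: "nat \<Rightarrow> 'v \<Rightarrow> 'v" where "approx_E n x = (sq ^^ n) (u + x /\<^sub>R 2 ^ n)"

definition E :: "'v \<Rightarrow> 'v" where "E x = lim (\<lambda>n. approx_E n x)"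

lemma approx_E_step: "norm (approx_E (Suc n) x - approx_E n x) \<le> (exp (K * norm x) * K * (norm x)\<^sup>2 / 4) / 2 ^ n"
proof -
  define h where "h = x /\<^sub>R 2"
  have "approx_E (Suc n) x = (sq ^^ n) ((u + h /\<^sub>R 2 ^ n) \<star> (u + h /\<^sub>R 2 ^ n))"
    unfolding approx_E_def h_def by (simp add: funpow_swap1 sq_def)
  moreover have "approx_E n x = (sq ^^ n) (u + (h + h) /\<^sub>R 2 ^ n)"
    unfolding approx_E_def h_def by (simp flip: scaleR_add_left)
  moreover have "norm x = 2 * norm h" unfolding h_def by simp
  ultimately show ?thesis using sq_iter_compare[of n h h] by (simp add: power2_eq_square)
qed

lemma approx_E_tendsto: "(\<lambda>n. approx_E n x) \<longlonglongrightarrow> E x"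
proof -
  define c where "c = exp (K * norm x) * K * (norm x)\<^sup>2 / 4"
  have c: "0 \<le> c" unfolding c_def using K(1) by simp
  have bd: "norm (approx_E (n + k) x - approx_E n x) \<le> 2 * c / 2 ^ n" for n k
    using geometric_steps_bound[of "\<lambda>n. approx_E n x" c] approx_E_step c unfolding c_def by blast
  have lim0: "(\<lambda>n. 2 * c / 2 ^ n) \<longlonglongrightarrow> 0" by (rule LIMSEQ_divide_realpow_zero) simp
  have "Cauchy (\<lambda>n. approx_E n x)"
  proof (rule CauchyI')
    fix e :: real assume "0 < e"
    then obtain M where M: "\<And>n. n \<ge> M \<Longrightarrow> 2 * c / 2 ^ n < e"
      using order_tendstoD(2)[OF lim0] unfolding eventually_sequentially by blast
    have "norm (approx_E m x - approx_E n x) < e" if "m \<ge> M" "n > m" for m n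
      using bd[of m "n - m"] M[OF that(1)] that(2) by (simp add: norm_minus_commute)
    then show "\<exists>M. \<forall>m\<ge>M. \<forall>n>m. dist (approx_E m x) (approx_E n x) < e" unfolding dist_norm by blast
  qed
  then have "convergent (\<lambda>n. approx_E n x)" by (rule Cauchy_convergent_fd)
  then show ?thesis unfolding E_def by (simp add: convergent_LIMSEQ_iff)
qed

lemma E_near: "norm (E x - u - x) \<le> exp (K * norm x) * K * (norm x)\<^sup>2"
proof -
  define c where "c = exp (K * norm x) * K * (norm x)\<^sup>2 / 4"
  have c: "0 \<le> c" unfolding c_def using K(1) by simp
  have "norm (approx_E (0 + k) x - approx_E 0 x) \<le> 2 * c / 2 ^ 0" for k
    using geometric_steps_bound[of "\<lambda>n. approx_E n x" c] approx_E_step c unfolding c_def by blast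
  then have bd: "norm (approx_E k x - (u + x)) \<le> 2 * c" for k by (simp add: approx_E_def)
  have "(\<lambda>k. norm (approx_E k x - (u + x))) \<longlonglongrightarrow> norm (E x - (u + x))"
    by (intro tendsto_intros approx_E_tendsto)
  then have "norm (E x - (u + x)) \<le> 2 * c"
    by (rule LIMSEQ_le_const2) (use bd in blast)
  then show ?thesis using c unfolding c_def diff_diff_eq by linarith
qed

lemma E_add: "E (x + y) = E x \<star> E y"
proof (rule LIMSEQ_unique)
  show "(\<lambda>n. approx_E n x \<star> approx_E n y) \<longlonglongrightarrow> E x \<star> E y"
    by (intro m.tendsto approx_E_tendsto)
  have "(\<lambda>n. approx_E n x \<star> approx_E n y - approx_E n (x + y)) \<longlonglongrightarrow> 0"
  proof (rule Lim_null_comparison[OF always_eventually])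
    show "\<forall>n. norm (approx_E n x \<star> approx_E n y - approx_E n (x + y)) \<le> exp (K * (norm x + norm y)) * K * norm x * norm y / 2 ^ n"
      using sq_iter_compare unfolding approx_E_def by (simp add: sq_iter_mult)
    show "(\<lambda>n. exp (K * (norm x + norm y)) * K * norm x * norm y / 2 ^ n) \<longlonglongrightarrow> 0"
      by (rule LIMSEQ_divide_realpow_zero) simp
  qed
  from tendsto_add[OF this approx_E_tendsto[of "x + y"]]
  show "(\<lambda>n. approx_E n x \<star> approx_E n y) \<longlonglongrightarrow> E (x + y)" by simp
qed

lemma E_0: "E 0 = u"
  using E_near[of 0] by simp

lemma E_minus: "E x \<star> E (- x) = u" "E (- x) \<star> E x = u"
  by (simp_all add: E_0 flip: E_add)

lemma E_scaleR_unit: "E (t *\<^sub>R u) = exp t *\<^sub>R u"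
proof (rule LIMSEQ_unique[OF approx_E_tendsto])
  have "approx_E n (t *\<^sub>R u) = ((1 + t / real (2 ^ n)) ^ 2 ^ n) *\<^sub>R u" for n
  proof -
    have "u + (t *\<^sub>R u) /\<^sub>R 2 ^ n = (1 + t / 2 ^ n) *\<^sub>R u"
      by (simp add: scaleR_add_left divide_inverse mult.commute)
    then show ?thesis unfolding approx_E_def by (simp add: sq_iter_scaleR sq_iter_unit)
  qed
  moreover have "(\<lambda>n. (1 + t / real (2 ^ n)) ^ 2 ^ n) \<longlonglongrightarrow> exp t"
    using LIMSEQ_subseq_LIMSEQ[OF tendsto_exp_limit_sequentially[of t], of "\<lambda>n. 2 ^ n"]
    by (simp add: o_def strict_mono_def)
  ultimately show "(\<lambda>n. approx_E n (t *\<^sub>R u)) \<longlonglongrightarrow> exp t *\<^sub>R u"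
    by (simp add: tendsto_scaleR)
qed

lemma E_bound: "norm (E x) \<le> norm u + norm x + exp (K * norm x) * K * (norm x)\<^sup>2"
proof -
  have "norm (E x) \<le> norm (E x - u - x) + norm (u + x)"
    using norm_triangle_ineq[of "E x - u - x" "u + x"] by (simp add: algebra_simps)
  then show ?thesis using E_near[of x] norm_triangle_ineq[of u x] by linarith
qed

lemma E_bound_mono:
  assumes "norm x \<le> r"
  shows "norm (E x) \<le> norm u + r + exp (K * r) * K * r\<^sup>2"
proof -
  have "exp (K * norm x) * K * (norm x)\<^sup>2 \<le> exp (K * r) * K * r\<^sup>2"
    using assms K(1) by (intro mult_mono power_mono) auto
  then show ?thesis using E_bound[of x] assms by linarith
qed

lemma E_tendsto_unit:
  assumes "(X \<longlongrightarrow> 0) F"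
  shows "((\<lambda>i. E (X i)) \<longlongrightarrow> u) F"
proof -
  have "((\<lambda>i. exp (K * norm (X i)) * K * (norm (X i))\<^sup>2) \<longlongrightarrow> exp (K * norm (0::'v)) * K * (norm (0::'v))\<^sup>2) F"
    by (intro tendsto_intros assms)
  then have "((\<lambda>i. E (X i) - u - X i) \<longlongrightarrow> 0) F"
    by (intro Lim_null_comparison[OF always_eventually, of "\<lambda>i. E (X i) - u - X i"]) (auto intro: E_near)
  from tendsto_add[OF tendsto_add[OF this assms] tendsto_const[of u]] show ?thesis by simp
qed

text \<open>\<open>E\<close> is onto a neighbourhood of the unit, with a linear bound on the logarithm. A solution of
  \<open>E x = a\<close> is a fixed point of \<open>x \<mapsto> x + a - E x\<close>, which is a contraction near \<open>0\<close>: by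
  \<open>E x - E y = E y (E (x - y) - u)\<close>, the map \<open>E\<close> differs from a translation by a term of second
  order.\<close>

lemma E_local_surj:
  "\<exists>\<epsilon>>0. \<forall>a. norm (a - u) < \<epsilon> \<longrightarrow> (\<exists>x. E x = a \<and> norm x \<le> 2 * norm (a - u))"
proof -
  define h where "h t = t + exp (K * t) * K * t\<^sup>2" for t
  \<comment> \<open>\<open>C t\<close> bounds the Lipschitz constant of \<open>E x - x\<close> on the ball of radius \<open>t\<close>.\<close>
  define C where "C t = K * (norm u + h t) * (exp (K * (2 * t)) * K * (2 * t)) + K * h t" for t
  have "((\<lambda>t. C t) \<longlongrightarrow> C 0) (at_right 0)"
    unfolding C_def h_def by (intro tendsto_intros)
  then have "((\<lambda>t. C t) \<longlongrightarrow> 0) (at_right 0)" by (simp add: C_def h_def)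
  then have "eventually (\<lambda>t. C t < 1/2) (at_right 0)"
    by (rule order_tendstoD) simp
  moreover have "((\<lambda>t. exp (K * t) * K * t) \<longlongrightarrow> exp (K * 0) * K * 0) (at_right 0)"
    by (intro tendsto_intros)
  then have "eventually (\<lambda>t. exp (K * t) * K * t < 1/2) (at_right 0)"
    by (rule order_tendstoD) simp
  ultimately have "eventually (\<lambda>t. C t < 1/2 \<and> exp (K * t) * K * t < 1/2 \<and> t > 0) (at_right (0::real))"
    by (intro eventually_conj eventually_at_right_less)
  then obtain \<eta> where \<eta>: "C \<eta> < 1/2" "exp (K * \<eta>) * K * \<eta> < 1/2" "\<eta> > 0"
    using eventually_happens'[OF trivial_limit_at_right_real] by blast
  have K0: "0 \<le> K" using K(1) by simp
  have quad: "norm (E z - u - z) \<le> exp (K * t) * K * t * norm z" if "norm z \<le> t" for z t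
  proof -
    have "exp (K * norm z) * K * (norm z * norm z) \<le> exp (K * t) * K * (t * norm z)"
      using that K0 order_trans[OF norm_ge_zero that]
      by (intro mult_mono) (auto intro: mult_left_mono)
    then show ?thesis using E_near[of z] by (simp add: power2_eq_square mult.assoc)
  qed
  have Eu: "norm (E y - u) \<le> h \<eta>" if "norm y \<le> \<eta>" for y
  proof -
    have "exp (K * norm y) * K * (norm y)\<^sup>2 \<le> exp (K * \<eta>) * K * \<eta>\<^sup>2"
      using that K0 by (intro mult_mono power_mono) (auto intro: mult_left_mono)
    then show ?thesis using E_near[of y] norm_triangle_ineq[of "E y - u - y" y] that
      unfolding h_def by simp
  qed
  have h0: "0 \<le> h \<eta>" unfolding h_def using \<eta>(3) K0 by simp
  have lip: "norm (E x - E y - (x - y)) \<le> 1/2 * norm (x - y)" if "norm x \<le> \<eta>" "norm y \<le> \<eta>" for x y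
  proof -
    define z where "z = x - y"
    have nz: "norm z \<le> 2 * \<eta>" unfolding z_def using norm_triangle_ineq4[of x y] that by simp
    have "E x = E y \<star> E z" unfolding z_def by (simp flip: E_add)
    then have "E x - E y - z = E y \<star> (E z - u - z) + (E y - u) \<star> z"
      by (simp add: distribs unit unit_right)
    also have "norm \<dots> \<le> norm (E y \<star> (E z - u - z)) + norm ((E y - u) \<star> z)"
      by (rule norm_triangle_ineq)
    also have "\<dots> \<le> K * norm (E y) * norm (E z - u - z) + K * norm (E y - u) * norm z"
      by (intro add_mono K(2))
    also have "\<dots> \<le> K * (norm u + h \<eta>) * (exp (K * (2 * \<eta>)) * K * (2 * \<eta>) * norm z) + K * h \<eta> * norm z"
    proof (intro add_mono mult_mono mult_left_mono quad nz Eu that)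
      show "norm (E y) \<le> norm u + h \<eta>"
        using Eu[OF that(2)] norm_triangle_ineq2[of "E y" u] by linarith
    qed (use K0 h0 in auto)
    also have "\<dots> = C \<eta> * norm z" unfolding C_def by (simp add: algebra_simps)
    also have "\<dots> \<le> 1/2 * norm z" using \<eta>(1) by (intro mult_right_mono) auto
    finally show ?thesis unfolding z_def .
  qed
  have "\<exists>x. E x = a \<and> norm x \<le> 2 * norm (a - u)" if a: "norm (a - u) < \<eta> / 2" for a
  proof -
    define \<delta> where "\<delta> = norm (a - u)"
    define \<phi> where "\<phi> x = x + a - E x" for x
    have small: "norm x \<le> \<eta>" if "x \<in> cball 0 (2 * \<delta>)" for x using that a unfolding \<delta>_def by simp
    have "\<exists>!x. x \<in> cball 0 (2 * \<delta>) \<and> \<phi> x = x"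
    proof (rule Banach_fix[where c = "1/2"])
      show "complete (cball (0::'v) (2 * \<delta>))"
        by (intro compact_imp_complete compact_cball_finite_dim[OF B])
      show "\<phi> ` cball 0 (2 * \<delta>) \<subseteq> cball 0 (2 * \<delta>)"
      proof
        fix y assume "y \<in> \<phi> ` cball 0 (2 * \<delta>)"
        then obtain x where x: "x \<in> cball 0 (2 * \<delta>)" "y = \<phi> x" by blast
        have "\<phi> x = (a - u) - (E x - u - x)" unfolding \<phi>_def by simp
        then have "norm (\<phi> x) \<le> \<delta> + norm (E x - u - x)"
          unfolding \<delta>_def by (metis norm_triangle_ineq4)
        also have "\<dots> \<le> \<delta> + exp (K * \<eta>) * K * \<eta> * norm x" using quad[OF small[OF x(1)]] by simp
        also have "\<dots> \<le> \<delta> + 1/2 * norm x" using \<eta>(2) by (intro add_left_mono mult_right_mono) auto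
        finally show "y \<in> cball 0 (2 * \<delta>)" using x by simp
      qed
      show "dist (\<phi> x) (\<phi> y) \<le> 1/2 * dist x y"
        if "x \<in> cball 0 (2 * \<delta>)" "y \<in> cball 0 (2 * \<delta>)" for x y
      proof -
        have "\<phi> x - \<phi> y = - (E x - E y - (x - y))" unfolding \<phi>_def by simp
        then have "norm (\<phi> x - \<phi> y) = norm (E x - E y - (x - y))" by (metis norm_minus_cancel)
        then show ?thesis using lip[OF small[OF that(1)] small[OF that(2)]] by (simp add: dist_norm)
      qed
    qed (auto simp: \<delta>_def)
    then obtain x where "x \<in> cball 0 (2 * \<delta>)" "\<phi> x = x" by blast
    then show ?thesis unfolding \<phi>_def \<delta>_def by (intro exI[of _ x]) auto
  qed
  then show ?thesis using \<eta>(3) by (intro exI[of _ "\<eta> / 2"]) auto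
qed

end

section \<open>Powers of units that have a logarithm\<close>

text \<open>Compared coefficient by coefficient in the basis \<open>W\<close> of eigenvectors, \<open>h z = - \<mu> z\<close> says
  \<open>c b (\<nu> b + \<mu>) = 0\<close>, with a positive second factor.\<close>

lemma negative_eigenvector_in_positive_span:
  fixes h :: "'v::real_vector \<Rightarrow> 'v"
  assumes W: "finite W" "independent W" and h: "linear h"
    and ev: "\<And>b. b \<in> W \<Longrightarrow> \<exists>\<nu>>0. h b = \<nu> *\<^sub>R b"
    and z: "z \<in> span W" "h z = - \<mu> *\<^sub>R z" "0 < \<mu>"
  shows "z = 0"
proof -
  obtain c where c: "z = (\<Sum>b\<in>W. c b *\<^sub>R b)" using z(1) span_finite[OF W(1)] by auto
  obtain \<nu> where \<nu>: "\<And>b. b \<in> W \<Longrightarrow> 0 < \<nu> b \<and> h b = \<nu> b *\<^sub>R b" using ev by metis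
  have "h z = (\<Sum>b\<in>W. (c b * \<nu> b) *\<^sub>R b)"
    unfolding c using h \<nu> by (simp add: linear_sum linear_cmul)
  moreover have "- \<mu> *\<^sub>R z = (\<Sum>b\<in>W. (- \<mu> * c b) *\<^sub>R b)"
    unfolding c by (simp add: scaleR_sum_right)
  ultimately have "(\<Sum>b\<in>W. (c b * \<nu> b) *\<^sub>R b) - (\<Sum>b\<in>W. (- \<mu> * c b) *\<^sub>R b) = 0" using z(2) by simp
  then have "(\<Sum>b\<in>W. (c b * (\<nu> b + \<mu>)) *\<^sub>R b) = 0"
    by (simp add: algebra_simps flip: sum_subtractf)
  then have "c b * (\<nu> b + \<mu>) = 0" if "b \<in> W" for b
    using independentD[OF W(2,1) order_refl, of "\<lambda>b. c b * (\<nu> b + \<mu>)" b] that by blast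
  then have "c b = 0" if "b \<in> W" for b using \<nu>[OF that] z(3) that
    by (metis add_pos_pos less_irrefl mult_eq_0_iff)
  then show ?thesis unfolding c by simp
qed

context fd_comm_algebra
begin

text \<open>If every iterated square of \<open>a\<close> had an eigenvector with negative eigenvalue, these eigenvectors would
  form an infinite independent family: each is an eigenvector with \<^emph>\<open>positive\<close> eigenvalue for all
  later squares, so the next one is not in the span of its predecessors.\<close>

lemma exists_iterate_without_negative_eigenvalue:
  "\<exists>j. \<forall>w \<mu>. 0 < \<mu> \<longrightarrow> (sq ^^ j) a \<star> w = - \<mu> *\<^sub>R w \<longrightarrow> w = 0"
proof (rule ccontr)
  assume "\<not> ?thesis"
  then obtain w \<mu> where w: "\<And>j. 0 < \<mu> j" "\<And>j. (sq ^^ j) a \<star> w j = - \<mu> j *\<^sub>R w j" "\<And>j. w j \<noteq> (0::'v)"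
    by metis
  have sq_eig: "sq b \<star> z = (c * c) *\<^sub>R z" if "b \<star> z = c *\<^sub>R z" for b z c
    unfolding sq_def assoc that m.scaleR_right by simp
  have pos: "\<exists>\<nu>>0. (sq ^^ (j + Suc k)) a \<star> w j = \<nu> *\<^sub>R w j" for j k
  proof (induction k)
    case 0
    show ?case using sq_eig[OF w(2)[of j]] w(1)[of j] by (intro exI[of _ "\<mu> j * \<mu> j"]) simp
  next
    case (Suc k)
    then obtain \<nu> where "0 < \<nu>" "(sq ^^ (j + Suc k)) a \<star> w j = \<nu> *\<^sub>R w j" by blast
    then show ?case using sq_eig[of "(sq ^^ (j + Suc k)) a"] by (intro exI[of _ "\<nu> * \<nu>"]) simp
  qed
  have indep: "independent (w ` {..<n}) \<and> inj_on w {..<n}" for n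
  proof (induction n)
    case (Suc n)
    have "w n \<notin> span (w ` {..<n})"
    proof
      assume sp: "w n \<in> span (w ` {..<n})"
      have "w n = 0"
      proof (rule negative_eigenvector_in_positive_span[where h = "\<lambda>z. (sq ^^ n) a \<star> z"
            and W = "w ` {..<n}" and \<mu> = "\<mu> n", OF _ _ _ _ sp w(2) w(1)])
        show "linear (\<lambda>z. (sq ^^ n) a \<star> z)"
          by (rule bounded_linear.linear[OF m.bounded_linear_right])
        show "\<exists>\<nu>>0. (sq ^^ n) a \<star> b = \<nu> *\<^sub>R b" if b: "b \<in> w ` {..<n}" for b
        proof -
          obtain j where j: "j < n" "b = w j" using b by auto
          then have "n = j + Suc (n - Suc j)" by simp
          then show ?thesis using pos[of j "n - Suc j"] j(2) by simp
        qed
      qed (use Suc in auto)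
      then show False using w(3) by blast
    qed
    moreover from this have "w n \<notin> w ` {..<n}" using span_base[of "w n" "w ` {..<n}"] by metis
    ultimately show ?case using Suc by (simp add: lessThan_Suc independent_insert)
  qed (simp add: real_vector.independent_empty)
  have "card (w ` {..<Suc (card B)}) \<le> card B"
    using real_vector.independent_span_bound[OF B(1), of "w ` {..<Suc (card B)}"]
      indep[of "Suc (card B)"] B(3) by blast
  then show False using indep[of "Suc (card B)"] by (simp add: card_image)
qed

lemma injective_imp_inverse:
  assumes "\<And>w. a \<star> w = 0 \<Longrightarrow> w = 0"
  shows "\<exists>a'. a \<star> a' = u"
proof -
  interpret fd: finite_dimensional_vector_space "(*\<^sub>R) :: real \<Rightarrow> 'v \<Rightarrow> 'v" B
    by unfold_locales (use B in \<open>simp_all add: dependent_raw_def span_raw_def\<close>)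
  have lin: "linear (\<lambda>z. a \<star> z)" by (rule bounded_linear.linear[OF m.bounded_linear_right])
  then have "inj (\<lambda>z. a \<star> z)" using assms by (simp add: linear_injective_0)
  then have "surj (\<lambda>z. a \<star> z)" using lin fd.linear_inj_imp_surj by (simp add: linear_def)
  then show ?thesis by (metis surjD)
qed

text \<open>A singular point on the segment from \<open>u\<close> to \<open>h\<close> would give \<open>h\<close> an eigenvalue that is negative or
  \<open>0\<close>, so the segment consists of units. The image of \<open>E\<close> is a subgroup containing a neighbourhood of the
  unit, so membership in it is locally constant along the segment.\<close>

lemma in_range_E_if_no_negative_eigenvalue:
  assumes inj: "\<And>w. h \<star> w = 0 \<Longrightarrow> w = 0"
    and noneg: "\<And>w \<mu>. 0 < \<mu> \<Longrightarrow> h \<star> w = - \<mu> *\<^sub>R w \<Longrightarrow> w = 0"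
  shows "h \<in> range E"
proof -
  define p where "p t = (1 - t) *\<^sub>R u + t *\<^sub>R h" for t :: real
  have inv: "\<exists>a'. p t \<star> a' = u" if t: "t \<in> {0..1}" for t
  proof (rule injective_imp_inverse)
    fix w assume "p t \<star> w = 0"
    then have eq: "(1 - t) *\<^sub>R w + t *\<^sub>R (h \<star> w) = 0"
      unfolding p_def by (simp add: distribs m.scaleR_left unit)
    consider "t = 0" | "t = 1" | "0 < t" "t < 1" using t by fastforce
    then show "w = 0"
    proof cases
      case 3
      have "t *\<^sub>R (h \<star> w) = - ((1 - t) *\<^sub>R w)" using eq by (simp add: eq_neg_iff_add_eq_0 add.commute)
      then have "h \<star> w = (1 / t) *\<^sub>R (- ((1 - t) *\<^sub>R w))" using 3 by (metis divide_self_if less_irrefl scaleR_one scaleR_scaleR times_divide_eq_left mult_1)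
      then have "h \<star> w = - ((1 - t) / t) *\<^sub>R w" by (simp add: divide_inverse mult.commute)
      then show ?thesis using noneg[of "(1 - t) / t"] 3 by simp
    qed (use eq inj in auto)
  qed
  obtain \<epsilon> where \<epsilon>: "\<epsilon> > 0" "\<And>a. norm (a - u) < \<epsilon> \<Longrightarrow> a \<in> range E"
    using E_local_surj by (metis rangeI)
  have "(p 0 \<in> range E) = (p 1 \<in> range E)"
  proof (rule connected_local_const[where f = "\<lambda>t. p t \<in> range E" and A = "{0..1}"])
    show "\<forall>t\<in>{0..1}. eventually (\<lambda>t'. (p t \<in> range E) = (p t' \<in> range E)) (at t within {0..1})"
    proof
      fix t :: real assume t: "t \<in> {0..1}"
      obtain a' where a': "p t \<star> a' = u" using inv[OF t] by blast
      have "((\<lambda>t'. a' \<star> p t') \<longlongrightarrow> a' \<star> p t) (at t within {0..1})"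
        unfolding p_def by (intro m.tendsto tendsto_intros)
      then have "((\<lambda>t'. norm (a' \<star> p t' - u)) \<longlongrightarrow> 0) (at t within {0..1})"
        using a' by (simp add: commute LIM_zero_iff tendsto_norm_zero_iff)
      then have "eventually (\<lambda>t'. norm (a' \<star> p t' - u) < \<epsilon>) (at t within {0..1})"
        by (rule order_tendstoD) (rule \<epsilon>)
      then show "eventually (\<lambda>t'. (p t \<in> range E) = (p t' \<in> range E)) (at t within {0..1})"
      proof eventually_elim
        case (elim t')
        then obtain y where y: "a' \<star> p t' = E y" using \<epsilon>(2) by blast
        have fwd: "p t' = p t \<star> E y" using a' y by (metis assoc unit)
        then have bwd: "p t = p t' \<star> E (- y)" by (metis E_minus(1) assoc unit_right)
        show ?case
        proof
          assume "p t \<in> range E"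
          then obtain x where "p t = E x" by blast
          then have "p t' = E (x + y)" using fwd by (simp add: E_add)
          then show "p t' \<in> range E" by simp
        next
          assume "p t' \<in> range E"
          then obtain x where "p t' = E x" by blast
          then have "p t = E (x + - y)" unfolding E_add using bwd by simp
          then show "p t \<in> range E" by simp
        qed
      qed
    qed
  qed auto
  moreover have "p 0 = E 0" by (simp add: p_def E_0)
  ultimately show ?thesis by (simp add: p_def)
qed

lemma sq_E: "sq (E x) = E (2 *\<^sub>R x)"
  unfolding sq_def by (simp add: scaleR_2 E_add)

lemma sq_iter_E: "(sq ^^ n) (E x) = E (2 ^ n *\<^sub>R x)"
  by (induction n) (simp_all add: sq_E)

text \<open>Some power of every unit has a logarithm; a square may be needed, as for a negative scalar. All later
  iterated squares have one too, so that finitely many units can share the power.\<close>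

lemma sq_iter_in_range_E:
  assumes "\<And>w. a \<star> w = 0 \<Longrightarrow> w = 0"
  shows "\<exists>j. \<forall>k. (sq ^^ (k + j)) a \<in> range E"
proof -
  have inj: "(sq ^^ n) a \<star> w = 0 \<Longrightarrow> w = 0" for n w
  proof (induction n arbitrary: w)
    case 0
    then show ?case using assms[of w] by simp
  next
    case (Suc n)
    then have "(sq ^^ n) a \<star> ((sq ^^ n) a \<star> w) = 0"
      by (simp add: sq_def[of "(sq ^^ n) a"] assoc)
    then show ?case using Suc.IH by metis
  qed
  obtain j where "\<forall>w \<mu>. 0 < \<mu> \<longrightarrow> (sq ^^ j) a \<star> w = - \<mu> *\<^sub>R w \<longrightarrow> w = 0"
    using exists_iterate_without_negative_eigenvalue by blast
  then have "(sq ^^ j) a \<in> range E" using inj by (intro in_range_E_if_no_negative_eigenvalue) blast+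
  then have "\<forall>k. (sq ^^ (k + j)) a \<in> range E" by (auto simp: funpow_add sq_iter_E)
  then show ?thesis by blast
qed

lemma common_iterate_in_range_E:
  assumes "finite \<Gamma>" "\<And>\<gamma> w. \<gamma> \<in> \<Gamma> \<Longrightarrow> \<gamma> \<star> w = 0 \<Longrightarrow> w = 0"
  shows "\<exists>J. \<forall>\<gamma>\<in>\<Gamma>. (sq ^^ J) \<gamma> \<in> range E"
proof -
  have "\<forall>\<gamma>\<in>\<Gamma>. \<exists>j. \<forall>k. (sq ^^ (k + j)) \<gamma> \<in> range E"
    using assms(2) sq_iter_in_range_E by blast
  then obtain j where j: "\<forall>\<gamma>\<in>\<Gamma>. \<forall>k. (sq ^^ (k + j \<gamma>)) \<gamma> \<in> range E" by metis
  have "(sq ^^ Max (j ` \<Gamma>)) \<gamma> \<in> range E" if "\<gamma> \<in> \<Gamma>" for \<gamma>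
  proof -
    have "j \<gamma> \<le> Max (j ` \<Gamma>)" using that assms(1) by simp
    then show ?thesis using j that by (metis le_add_diff_inverse2)
  qed
  then show ?thesis by blast
qed

section \<open>Coarsely dense semigroups of units\<close>

text \<open>The directions of the maximal compact subgroup: those \<open>x\<close> whose one-parameter group \<open>t \<mapsto> E (t x)\<close>
  stays bounded. They contain the kernel of \<open>E\<close>, so a linear functional that vanishes on them is a
  well-defined function of \<open>E x\<close>.\<close>

definition bounded_directions :: "'v set" where "bounded_directions = {x. \<exists>M. \<forall>t. norm (E (t *\<^sub>R x)) \<le> M}"

lemma subspace_bounded_directions: "subspace bounded_directions"
proof (rule subspaceI)
  show "0 \<in> bounded_directions" unfolding bounded_directions_def by auto
next
  fix x y assume "x \<in> bounded_directions" "y \<in> bounded_directions"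
  then obtain M N where M: "\<And>t. norm (E (t *\<^sub>R x)) \<le> M" and N: "\<And>t. norm (E (t *\<^sub>R y)) \<le> N"
    unfolding bounded_directions_def by blast
  have "norm (E (t *\<^sub>R (x + y))) \<le> K * M * N" for t
  proof -
    have "norm (E (t *\<^sub>R (x + y))) \<le> K * norm (E (t *\<^sub>R x)) * norm (E (t *\<^sub>R y))"
      unfolding scaleR_add_right E_add by (rule K(2))
    also have "\<dots> \<le> K * M * N" using K(1) M[of t] N[of t] order_trans[OF norm_ge_zero M[of t]]
      by (intro mult_mono) auto
    finally show ?thesis .
  qed
  then show "x + y \<in> bounded_directions" unfolding bounded_directions_def by blast
next
  fix c x assume "x \<in> bounded_directions"
  then show "c *\<^sub>R x \<in> bounded_directions" unfolding bounded_directions_def by (auto simp: scaleR_scaleR)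
qed

lemma kernel_E_in_bounded_directions:
  assumes "E x = u"
  shows "x \<in> bounded_directions"
proof -
  have int: "E (of_int n *\<^sub>R x) = u" for n :: int
  proof (induction n rule: int_induct[of _ 0])
    case base
    then show ?case by (simp add: E_0)
  next
    case (step1 i)
    then show ?case using assms by (simp add: scaleR_add_left E_add unit)
  next
    case (step2 i)
    have "E (- x) = u" using E_minus(1)[of x] assms by (simp add: unit)
    then show ?case using step2 E_add[of "of_int i *\<^sub>R x" "- x"] by (simp add: scaleR_diff_left unit)
  qed
  have "norm (E (t *\<^sub>R x)) \<le> norm u + norm x + exp (K * norm x) * K * (norm x)\<^sup>2" for t
  proof -
    have "t *\<^sub>R x = of_int \<lfloor>t\<rfloor> *\<^sub>R x + frac t *\<^sub>R x"
      by (simp add: frac_def flip: scaleR_add_left)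
    then have "E (t *\<^sub>R x) = E (frac t *\<^sub>R x)" by (simp add: E_add int unit)
    moreover have "norm (frac t *\<^sub>R x) \<le> norm x"
      using frac_lt_1[of t] frac_ge_0[of t] mult_right_mono[of "frac t" 1 "norm x"] by simp
    ultimately show ?thesis using E_bound_mono by metis
  qed
  then show ?thesis unfolding bounded_directions_def by blast
qed

lemma E_eq_imp_diff_in_bounded_directions: "E x = E y \<Longrightarrow> x - y \<in> bounded_directions"
  by (rule kernel_E_in_bounded_directions) (use E_add[of x "- y"] E_minus(1)[of y] in simp)

inductive_set products :: "'v set \<Rightarrow> 'v set" for \<Gamma> :: "'v set" where
  gen: "\<gamma> \<in> \<Gamma> \<Longrightarrow> \<gamma> \<in> products \<Gamma>"
| mul: "a \<in> products \<Gamma> \<Longrightarrow> b \<in> products \<Gamma> \<Longrightarrow> a \<star> b \<in> products \<Gamma>"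

lemma sq_iter_products: "a \<in> products \<Gamma> \<Longrightarrow> (sq ^^ n) a \<in> products \<Gamma>"
  by (induction n) (auto simp: sq_def intro: products.mul)

text \<open>The exponents are indexed by the logarithms, not by the generators: after passing to the power
  \<open>2\<^sup>J\<close>, generators with the same logarithm cannot be told apart.\<close>

lemma products_exponents:
  assumes fin: "finite \<Gamma>" and lg: "\<And>\<gamma>. \<gamma> \<in> \<Gamma> \<Longrightarrow> (sq ^^ J) \<gamma> = E (lg \<gamma>)" and s: "s \<in> products \<Gamma>"
  shows "\<exists>n. (sq ^^ J) s = E (\<Sum>x\<in>lg ` \<Gamma>. real (n x) *\<^sub>R x)"
  using s
proof induction
  case (gen \<gamma>)
  have "(\<Sum>x\<in>lg ` \<Gamma>. real (if x = lg \<gamma> then 1 else 0) *\<^sub>R x) = (\<Sum>x\<in>lg ` \<Gamma>. if x = lg \<gamma> then x else 0)"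
    by (intro sum.cong) auto
  also have "\<dots> = lg \<gamma>" using gen fin by simp
  finally show ?case using lg[OF gen] by metis
next
  case (mul a b)
  then obtain n n' where "(sq ^^ J) a = E (\<Sum>x\<in>lg ` \<Gamma>. real (n x) *\<^sub>R x)"
    "(sq ^^ J) b = E (\<Sum>x\<in>lg ` \<Gamma>. real (n' x) *\<^sub>R x)" by blast
  then show ?case
    by (intro exI[of _ "\<lambda>x. n x + n' x"]) (simp add: sq_iter_mult scaleR_add_left sum.distrib E_add)
qed

lemma positive_combination_in_products:
  assumes "finite X" "X \<noteq> {}" and E: "\<And>x. x \<in> X \<Longrightarrow> E x \<in> products \<Gamma>" and n: "\<And>x. x \<in> X \<Longrightarrow> 1 \<le> n x"
  shows "E (\<Sum>x\<in>X. real (n x) *\<^sub>R x) \<in> products \<Gamma>"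
proof -
  have E_n: "E (real k *\<^sub>R x) \<in> products \<Gamma>" if "1 \<le> k" "x \<in> X" for k x
    using that(1)
  proof (induction k rule: dec_induct)
    case base
    then show ?case using E[OF that(2)] by simp
  next
    case (step k)
    then show ?case using E[OF that(2)] by (simp add: scaleR_add_left E_add products.mul)
  qed
  show ?thesis using assms(1,2) E_n n
    by (induction X rule: finite_ne_induct) (simp_all add: E_add products.mul)
qed

text \<open>The functional \<open>f\<close> turns into an additive function on the semigroup with values in the combinations
  of the \<open>f x \<ge> 0\<close>. Rescaling by \<open>1 / R\<close> turns \<open>D\<close>-density into \<open>D / R\<close>-density near the unit, where
  \<open>f\<close> of the logarithm is Lipschitz and takes all values of a fixed interval. Since rescaling only adds
  a multiple of \<open>ln R\<close> to the values of \<open>f\<close>, they would be too numerous.\<close>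

lemma no_nonnegative_functional:
  assumes fin: "finite \<Gamma>" and lg: "\<And>\<gamma>. \<gamma> \<in> \<Gamma> \<Longrightarrow> (sq ^^ J) \<gamma> = E (lg \<gamma>)"
    and D: "0 < D" "\<And>w. \<exists>s\<in>products \<Gamma>. norm (w - s) < D"
    and f: "linear f" "\<And>y. y \<in> bounded_directions \<Longrightarrow> f y = 0" "\<And>x. x \<in> lg ` \<Gamma> \<Longrightarrow> 0 \<le> f x"
      "\<exists>x\<in>lg ` \<Gamma>. 0 < (f x :: real)"
  shows False
proof -
  obtain x0 where x0: "0 < f x0" using f(4) by blast
  define e where "e = x0 /\<^sub>R f x0"
  have fe: "f e = 1" unfolding e_def using f(1) x0 by (simp add: linear_cmul)
  obtain F where F: "0 < F" "\<And>y. \<bar>f y\<bar> \<le> norm y * F"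
    using bounded_linear.pos_bounded[OF bounded_linear_finite_dim[OF B f(1)]] by auto
  obtain \<epsilon> where \<epsilon>: "0 < \<epsilon>" "\<And>a. norm (a - u) < \<epsilon> \<Longrightarrow> \<exists>x. E x = a \<and> norm x \<le> 2 * norm (a - u)"
    using E_local_surj by blast
  define NE where "NE = 1 + (norm u + norm e + exp (K * norm e) * K * (norm e)\<^sup>2)"
  have NE: "1 \<le> NE" unfolding NE_def using K(1) by simp
  have NE_bd: "norm (E (- (\<tau> *\<^sub>R e))) \<le> NE" if "0 \<le> \<tau>" "\<tau> \<le> 1" for \<tau>
  proof -
    have "norm (- (\<tau> *\<^sub>R e)) \<le> norm e" using that mult_right_mono[of \<tau> 1 "norm e"] by simp
    from E_bound_mono[OF this] show ?thesis unfolding NE_def by simp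
  qed
  define A where "A = K * NE * D"
  have A: "0 < A" unfolding A_def using K(1) NE D by simp
  show False
  proof (rule combinations_not_log_dense[of "lg ` \<Gamma>" f "2 ^ J" "2 ^ J * F * (2 * A)" "max 1 (2 * A / \<epsilon>)" "2 ^ J * f u"])
    fix R \<tau> :: real assume R: "max 1 (2 * A / \<epsilon>) \<le> R" and \<tau>: "0 \<le> \<tau>" "\<tau> \<le> 1"
    have R1: "1 \<le> R" and R\<epsilon>: "A / R < \<epsilon>" using R A \<epsilon>(1) by (auto simp: field_simps)
    \<comment> \<open>The targets \<open>R E (\<tau> e)\<close> have logarithms on which \<open>f\<close> is \<open>f u ln R + \<tau>\<close>.\<close>
    define a where "a = R *\<^sub>R E (\<tau> *\<^sub>R e)"
    obtain s where s: "s \<in> products \<Gamma>" "norm (a - s) < D" using D(2) by blast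
    define b where "b = (1 / R) *\<^sub>R (E (- (\<tau> *\<^sub>R e)) \<star> s)"
    have "b - u = (1 / R) *\<^sub>R (E (- (\<tau> *\<^sub>R e)) \<star> (s - a))"
      unfolding b_def a_def using R1
      by (simp add: distribs m.scaleR_right E_minus scaleR_diff_right)
    then have "norm (b - u) = norm (E (- (\<tau> *\<^sub>R e)) \<star> (s - a)) / R" using R1 by simp
    also have "\<dots> \<le> A / R"
    proof (intro divide_right_mono)
      have "norm (E (- (\<tau> *\<^sub>R e)) \<star> (s - a)) \<le> K * norm (E (- (\<tau> *\<^sub>R e))) * norm (s - a)" by (rule K(2))
      also have "\<dots> \<le> K * NE * D"
        using K(1) NE_bd[OF \<tau>] s(2) NE by (intro mult_mono) (auto simp: norm_minus_commute)
      finally show "norm (E (- (\<tau> *\<^sub>R e)) \<star> (s - a)) \<le> A" unfolding A_def .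
    qed (use R1 in simp)
    finally have bu: "norm (b - u) \<le> A / R" .
    then obtain y where y: "E y = b" "norm y \<le> 2 * (A / R)"
      using \<epsilon>(2)[of b] R\<epsilon> by force
    define z where "z = ln R *\<^sub>R u + \<tau> *\<^sub>R e + y"
    have "E z = R *\<^sub>R (E (\<tau> *\<^sub>R e) \<star> b)"
      unfolding z_def E_add E_scaleR_unit y(1) using R1 by (simp add: m.scaleR_left unit)
    also have "\<dots> = E (\<tau> *\<^sub>R e) \<star> E (- (\<tau> *\<^sub>R e)) \<star> s"
      unfolding b_def using R1 by (simp add: m.scaleR_right assoc)
    also have "\<dots> = s" by (simp add: E_minus unit)
    finally have sz: "E z = s" .
    obtain n where n: "(sq ^^ J) s = E (\<Sum>x\<in>lg ` \<Gamma>. real (n x) *\<^sub>R x)"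
      using products_exponents[OF fin lg s(1)] by blast
    have "f ((\<Sum>x\<in>lg ` \<Gamma>. real (n x) *\<^sub>R x) - 2 ^ J *\<^sub>R z) = 0"
      by (rule f(2), rule E_eq_imp_diff_in_bounded_directions) (simp add: n sz flip: sq_iter_E)
    then have "(\<Sum>x\<in>lg ` \<Gamma>. real (n x) * f x) = 2 ^ J * f z"
      using f(1) by (simp add: linear_diff linear_sum linear_cmul)
    also have "\<dots> = 2 ^ J * f u * ln R + 2 ^ J * \<tau> + 2 ^ J * f y"
      unfolding z_def using f(1) fe by (simp add: linear_add linear_cmul algebra_simps)
    finally have eq: "(\<Sum>x\<in>lg ` \<Gamma>. real (n x) * f x) - (2 ^ J * f u * ln R + 2 ^ J * \<tau>) = 2 ^ J * f y" by simp
    have "norm y * F \<le> 2 * (A / R) * F" using y(2) F(1) by (intro mult_right_mono) auto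
    then have "2 ^ J * \<bar>f y\<bar> \<le> 2 ^ J * (2 * (A / R) * F)"
      using F(2)[of y] by (intro mult_left_mono) auto
    then have "\<bar>2 ^ J * f y\<bar> \<le> 2 ^ J * F * (2 * A) / R" by (simp add: abs_mult mult_ac)
    then show "\<exists>n. \<bar>(\<Sum>x\<in>lg ` \<Gamma>. real (n x) * f x) - (2 ^ J * f u * ln R + 2 ^ J * \<tau>)\<bar> \<le> 2 ^ J * F * (2 * A) / R"
      using eq by metis
  qed (use fin f(3) F A in auto)
qed

text \<open>The powers of \<open>E (\<Sum> t\<^sub>x x)\<close> are bounded in both directions. Rounding the exponents \<open>j t\<^sub>x\<close> down
  multiplies them by an element of a fixed compact set of units, so two of the rounded powers, with indices
  \<open>j\<close> at least 3 apart, are close to each other, and their quotient is close to the unit. The bound \<open>2\<close> on the exponents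
  leaves room to divide by one generator.\<close>

lemma recurrence:
  assumes X: "finite X" and t: "\<And>x. x \<in> X \<Longrightarrow> 1 \<le> t x" and C: "(\<Sum>x\<in>X. t x *\<^sub>R x) \<in> bounded_directions" and \<epsilon>: "0 < \<epsilon>"
  shows "\<exists>n. (\<forall>x\<in>X. 2 \<le> n x) \<and> norm (E (\<Sum>x\<in>X. real (n x) *\<^sub>R x) - u) < \<epsilon>"
proof -
  define w where "w = (\<Sum>x\<in>X. t x *\<^sub>R x)"
  define N where "N j x = nat \<lfloor>real j * t x\<rfloor>" for j :: nat and x
  define y where "y j = (\<Sum>x\<in>X. real (N j x) *\<^sub>R x)" for j
  define d where "d j = (\<Sum>x\<in>X. frac (real j * t x) *\<^sub>R x)" for j :: nat
  define r where "r = (\<Sum>x\<in>X. norm x)"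
  define b where "b = norm u + r + exp (K * r) * K * r\<^sup>2"
  have N: "real (N j x) = real j * t x - frac (real j * t x)" if "x \<in> X" for j x
    using t[OF that] unfolding N_def frac_def by simp
  have y: "y j = real j *\<^sub>R w - d j" for j
    unfolding y_def w_def d_def by (simp add: N scaleR_diff_left scaleR_sum_right flip: sum_subtractf)
  have d: "norm (d j) \<le> r" for j
    unfolding d_def r_def
    by (rule sum_norm_le) (simp add: mult_left_le_one_le frac_ge_0 less_imp_le[OF frac_lt_1])
  obtain M where M: "\<And>t. norm (E (t *\<^sub>R w)) \<le> M" using C unfolding bounded_directions_def w_def by blast
  have M0: "0 \<le> M" using order_trans[OF norm_ge_zero M] .
  have bd: "norm (E (t *\<^sub>R w + c)) \<le> K * M * b" if "norm c \<le> r" for t c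
  proof -
    have "norm (E (t *\<^sub>R w + c)) \<le> K * norm (E (t *\<^sub>R w)) * norm (E c)" unfolding E_add by (rule K(2))
    also have "\<dots> \<le> K * M * b"
      using K(1) M M0 E_bound_mono[OF that] unfolding b_def by (intro mult_mono) auto
    finally show ?thesis .
  qed
  have Ey: "norm (E (y j)) \<le> K * M * b" "norm (E (- y j)) \<le> K * M * b" for j
    using bd[of "- d j" "real j"] bd[of "d j" "- real j"] d[of j] unfolding y by simp_all
  define P where "P = K * M * b"
  have P0: "0 \<le> P" unfolding P_def using order_trans[OF norm_ge_zero Ey(1)] .
  have "seq_compact (cball (0::'v) P)"
    by (intro compact_imp_seq_compact compact_cball_finite_dim[OF B])
  then obtain l \<sigma> where \<sigma>: "strict_mono \<sigma>" "((\<lambda>j. E (y j)) \<circ> \<sigma>) \<longlonglongrightarrow> l"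
    unfolding seq_compact_def using Ey(1) P_def by (metis dist_0_norm mem_cball)
  define \<epsilon>' where "\<epsilon>' = \<epsilon> / (K * P + 1)"
  have KP: "0 \<le> K * P" using K(1) P0 by simp
  have \<epsilon>': "0 < \<epsilon>'" unfolding \<epsilon>'_def using \<epsilon> KP by simp
  have "Cauchy ((\<lambda>j. E (y j)) \<circ> \<sigma>)" using \<sigma>(2) by (rule LIMSEQ_imp_Cauchy)
  then obtain I where I: "\<And>i i'. i \<ge> I \<Longrightarrow> i' \<ge> I \<Longrightarrow> norm (E (y (\<sigma> i)) - E (y (\<sigma> i'))) < \<epsilon>'"
    using \<epsilon>' unfolding Cauchy_iff by fastforce
  define j j' where "j = \<sigma> I" and "j' = \<sigma> (I + 3)"
  \<comment> \<open>Since \<open>t x \<ge> 1\<close>, a gap of 3 between the indices keeps a gap of 2 after rounding.\<close>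
  have jj: "j + 3 \<le> j'"
  proof -
    have "\<sigma> I < \<sigma> (Suc I)" "\<sigma> (Suc I) < \<sigma> (Suc (Suc I))" "\<sigma> (Suc (Suc I)) < \<sigma> (Suc (Suc (Suc I)))"
      using \<sigma>(1) by (auto simp: strict_mono_def)
    then show ?thesis unfolding j_def j'_def by (simp add: numeral_3_eq_3)
  qed
  have N2: "N j x + 2 \<le> N j' x" if x: "x \<in> X" for x
  proof -
    have "(real j + 3) * t x \<le> real j' * t x" using jj t[OF x] by (intro mult_right_mono) auto
    then have "real j * t x + 3 \<le> real j' * t x" using t[OF x] by (simp add: distrib_right)
    then have "real (N j x) + 2 < real (N j' x)+ 1"
      using frac_lt_1[of "real j' * t x"] frac_ge_0[of "real j * t x"] unfolding N[OF x] by linarith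
    then show ?thesis by linarith
  qed
  have "(\<Sum>x\<in>X. real (N j' x - N j x) *\<^sub>R x) = (\<Sum>x\<in>X. (real (N j' x) - real (N j x)) *\<^sub>R x)"
    using N2 by (intro sum.cong) (fastforce simp: of_nat_diff)+
  then have s: "(\<Sum>x\<in>X. real (N j' x - N j x) *\<^sub>R x) = y j' + - y j"
    unfolding y_def by (simp add: scaleR_diff_left sum_subtractf)
  have "E (y j' + - y j) - u = E (- y j) \<star> (E (y j') - E (y j))"
    unfolding E_add by (simp add: distribs E_minus commute)
  then have "norm (E (y j' + - y j) - u) \<le> K * norm (E (- y j)) * norm (E (y j') - E (y j))"
    using K(2) by simp
  also have "\<dots> \<le> K * P * \<epsilon>'"
    using K(1) Ey(2)[of j] I[of "I + 3" I] P0 unfolding P_def j_def j'_def by (intro mult_mono) auto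
  also have "\<dots> < \<epsilon>" unfolding \<epsilon>'_def using KP \<epsilon> by (simp add: field_simps)
  finally have "norm (E (\<Sum>x\<in>X. real (N j' x - N j x) *\<^sub>R x) - u) < \<epsilon>" unfolding s .
  moreover have "\<forall>x\<in>X. 2 \<le> N j' x - N j x" using N2 by fastforce
  ultimately show ?thesis by (intro exI[of _ "\<lambda>x. N j' x - N j x"]) blast
qed

text \<open>With the functional excluded, Stiemke's alternative leaves a positive relation, and recurrence then
  places the unit and the inverses of the generators' powers, hence of all elements, in the closure \<open>H\<close>.
  Quotients are dense for an elementary reason: for \<open>s\<close> within \<open>D\<close> of \<open>R u\<close> and \<open>q\<close> within \<open>D\<close> of
  \<open>R w\<close>, the quotient \<open>q / s\<close> tends to \<open>w\<close> as \<open>R\<close> grows.\<close>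

theorem coarsely_dense_products_dense:
  assumes fin: "finite \<Gamma>" and inj: "\<And>\<gamma> w. \<gamma> \<in> \<Gamma> \<Longrightarrow> \<gamma> \<star> w = 0 \<Longrightarrow> w = 0"
    and D: "0 < D" "\<And>w. \<exists>s\<in>products \<Gamma>. norm (w - s) < D"
  shows "closure (products \<Gamma>) = UNIV"
proof -
  define H where "H = closure (products \<Gamma>)"
  obtain J where J: "\<forall>\<gamma>\<in>\<Gamma>. (sq ^^ J) \<gamma> \<in> range E" using common_iterate_in_range_E[OF fin] inj by meson
  then have "\<forall>\<gamma>\<in>\<Gamma>. \<exists>y. (sq ^^ J) \<gamma> = E y" by blast
  from bchoice[OF this] obtain lg where lg: "\<And>\<gamma>. \<gamma> \<in> \<Gamma> \<Longrightarrow> (sq ^^ J) \<gamma> = E (lg \<gamma>)" by blast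
  define X where "X = lg ` \<Gamma>"
  have X: "finite X" unfolding X_def using fin by simp
  have EX: "E x \<in> products \<Gamma>" if x: "x \<in> X" for x
  proof -
    obtain \<gamma> where \<gamma>: "\<gamma> \<in> \<Gamma>" "x = lg \<gamma>" using x unfolding X_def by blast
    show ?thesis using sq_iter_products[OF products.gen[OF \<gamma>(1)], of J] lg[OF \<gamma>(1)] \<gamma>(2) by simp
  qed
  have "\<Gamma> \<noteq> {}"
  proof
    assume "\<Gamma> = {}"
    moreover have "s \<in> products \<Gamma> \<Longrightarrow> \<Gamma> \<noteq> {}" for s by (induction rule: products.induct) auto
    ultimately show False using D(2) by blast
  qed
  then have Xne: "X \<noteq> {}" unfolding X_def by simp
  obtain t where t: "\<And>x. x \<in> X \<Longrightarrow> 1 \<le> t x" "(\<Sum>x\<in>X. t x *\<^sub>R x) \<in> bounded_directions"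
  proof -
    have "\<not> (\<exists>f. linear f \<and> (\<forall>y\<in>bounded_directions. f y = 0) \<and> (\<forall>x\<in>X. 0 \<le> f x) \<and> (\<exists>x\<in>X. 0 < (f x :: real)))"
    proof
      assume "\<exists>f. linear f \<and> (\<forall>y\<in>bounded_directions. f y = 0) \<and> (\<forall>x\<in>X. 0 \<le> f x) \<and> (\<exists>x\<in>X. 0 < (f x :: real))"
      then obtain f where f: "linear f" "\<forall>y\<in>bounded_directions. f y = 0" "\<forall>x\<in>X. 0 \<le> f x" "\<exists>x\<in>X. 0 < (f x :: real)"
        by blast
      show False
        by (rule no_nonnegative_functional[OF fin lg D f(1)]) (use f in \<open>auto simp: X_def\<close>)
    qed
    with stiemke_alternative[OF X subspace_bounded_directions] that show ?thesis by blast
  qed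
  have H_products: "products \<Gamma> \<subseteq> H" unfolding H_def by (rule closure_subset)
  have H_mult: "a \<star> b \<in> H" if ab: "a \<in> H" "b \<in> H" for a b
  proof -
    obtain p q where "\<And>i. p i \<in> products \<Gamma>" "p \<longlonglongrightarrow> a" "\<And>i. q i \<in> products \<Gamma>" "q \<longlonglongrightarrow> b"
      using ab unfolding H_def closure_sequential by blast
    then show ?thesis unfolding H_def closure_sequential
      by (intro exI[of _ "\<lambda>i. p i \<star> q i"]) (auto intro: products.mul m.tendsto)
  qed
  have H_u: "u \<in> H"
    unfolding H_def closure_approachable
  proof (intro allI impI)
    fix \<epsilon> :: real assume "0 < \<epsilon>"
    then obtain n where n: "\<forall>x\<in>X. 2 \<le> n x" "norm (E (\<Sum>x\<in>X. real (n x) *\<^sub>R x) - u) < \<epsilon>"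
      using recurrence[OF X t] by blast
    have "E (\<Sum>x\<in>X. real (n x) *\<^sub>R x) \<in> products \<Gamma>"
      using n(1) by (intro positive_combination_in_products X Xne EX) auto
    then show "\<exists>y\<in>products \<Gamma>. dist y u < \<epsilon>" using n(2) by (auto simp: dist_norm)
  qed
  have H_inv: "E (- x0) \<in> H" if x0: "x0 \<in> X" for x0
    unfolding H_def closure_approachable
  proof (intro allI impI)
    fix \<epsilon> :: real assume \<epsilon>: "0 < \<epsilon>"
    define \<epsilon>' where "\<epsilon>' = \<epsilon> / (K * norm (E (- x0)) + 1)"
    have KE: "0 \<le> K * norm (E (- x0))" using K(1) by simp
    have "0 < \<epsilon>'" unfolding \<epsilon>'_def using \<epsilon> KE by simp
    then obtain n where n: "\<forall>x\<in>X. 2 \<le> n x" "norm (E (\<Sum>x\<in>X. real (n x) *\<^sub>R x) - u) < \<epsilon>'"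
      using recurrence[OF X t] by blast
    \<comment> \<open>Dividing a nearly trivial product by \<open>E x0\<close> leaves a product that is close to the inverse of \<open>E x0\<close>.\<close>
    define n' where "n' x = (if x = x0 then n x - 1 else n x)" for x
    have "(\<Sum>x\<in>X. real (n' x) *\<^sub>R x) = (\<Sum>x\<in>X. real (n x) *\<^sub>R x + (if x = x0 then - x else 0))"
    proof (rule sum.cong)
      fix x assume x: "x \<in> X"
      then have "real (n x - 1) = real (n x) - 1" using n(1) by (fastforce simp: of_nat_diff)
      then show "real (n' x) *\<^sub>R x = real (n x) *\<^sub>R x + (if x = x0 then - x else 0)"
        unfolding n'_def by (cases "x = x0") (simp_all add: scaleR_diff_left)
    qed simp
    also have "\<dots> = (\<Sum>x\<in>X. real (n x) *\<^sub>R x) + - x0" using X x0 by (simp add: sum.distrib)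
    finally have sum: "(\<Sum>x\<in>X. real (n' x) *\<^sub>R x) = (\<Sum>x\<in>X. real (n x) *\<^sub>R x) + - x0" .
    have mem: "E (\<Sum>x\<in>X. real (n' x) *\<^sub>R x) \<in> products \<Gamma>"
      using n(1) by (intro positive_combination_in_products X Xne EX) (fastforce simp: n'_def)+
    have "E (\<Sum>x\<in>X. real (n' x) *\<^sub>R x) - E (- x0) = E (- x0) \<star> (E (\<Sum>x\<in>X. real (n x) *\<^sub>R x) - u)"
      unfolding sum E_add by (simp add: distribs unit unit_right commute)
    then have "norm (E (\<Sum>x\<in>X. real (n' x) *\<^sub>R x) - E (- x0)) \<le> K * norm (E (- x0)) * norm (E (\<Sum>x\<in>X. real (n x) *\<^sub>R x) - u)"
      using K(2) by simp
    also have "\<dots> \<le> K * norm (E (- x0)) * \<epsilon>'" using KE n(2) by (intro mult_left_mono) auto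
    also have "\<dots> < \<epsilon>" unfolding \<epsilon>'_def using KE \<epsilon> by (simp add: field_simps)
    finally show "\<exists>y\<in>products \<Gamma>. dist y (E (- x0)) < \<epsilon>" using mem by (auto simp: dist_norm)
  qed
  have H_inv_nat: "E (- (real k *\<^sub>R x)) \<in> H" if "x \<in> X" for k x
  proof (induction k)
    case (Suc k)
    have "- (real (Suc k) *\<^sub>R x) = - (real k *\<^sub>R x) + - x" by (simp add: scaleR_add_left)
    then show ?case using Suc H_inv[OF that] by (simp only: E_add H_mult)
  qed (simp add: E_0 H_u)
  have H_inv_sum: "E (- (\<Sum>x\<in>X. real (n x) *\<^sub>R x)) \<in> H" for n
    using X H_inv_nat
  proof (induction X rule: finite_induct)
    case (insert x F)
    have "- (\<Sum>x\<in>insert x F. real (n x) *\<^sub>R x) = - (real (n x) *\<^sub>R x) + - (\<Sum>x\<in>F. real (n x) *\<^sub>R x)"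
      using insert.hyps by simp
    moreover have "E (- (\<Sum>x\<in>F. real (n x) *\<^sub>R x)) \<in> H" using insert by blast
    ultimately show ?case using insert.prems by (simp only: E_add H_mult insertI1)
  qed (simp add: E_0 H_u)
  \<comment> \<open>The unit is added because for \<open>n = 0\<close> nothing is left after dividing by \<open>s\<close>.\<close>
  have factor: "\<exists>p\<in>insert u (products \<Gamma>). (sq ^^ n) s = s \<star> p" if s: "s \<in> products \<Gamma>" for s n
  proof (induction n)
    case 0
    then show ?case by (auto simp: unit_right)
  next
    case (Suc n)
    then obtain p where p: "p \<in> insert u (products \<Gamma>)" "(sq ^^ n) s = s \<star> p" by blast
    have "(sq ^^ Suc n) s = s \<star> (p \<star> (sq ^^ n) s)" by (simp add: sq_def p(2) assoc)
    moreover have "p \<star> (sq ^^ n) s \<in> products \<Gamma>"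
      using p(1) sq_iter_products[OF s, of n] by (auto simp: unit intro: products.mul)
    ultimately show ?case by blast
  qed
  have inverse: "\<exists>s'\<in>H. s \<star> s' = u" if s: "s \<in> products \<Gamma>" for s
  proof -
    obtain p where p: "p \<in> insert u (products \<Gamma>)" "(sq ^^ J) s = s \<star> p" using factor[OF s] by blast
    obtain n where n: "(sq ^^ J) s = E (\<Sum>x\<in>X. real (n x) *\<^sub>R x)"
      using products_exponents[OF fin lg s] unfolding X_def by blast
    have "s \<star> (p \<star> E (- (\<Sum>x\<in>X. real (n x) *\<^sub>R x))) = u"
      using p(2) n E_minus(1) by (metis assoc)
    moreover have "p \<in> H" using p(1) H_u H_products by auto
    ultimately show ?thesis using H_mult H_inv_sum by blast
  qed
  obtain \<epsilon> where \<epsilon>: "0 < \<epsilon>" "\<forall>a. norm (a - u) < \<epsilon> \<longrightarrow> (\<exists>x. E x = a \<and> norm x \<le> 2 * norm (a - u))"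
    using E_local_surj by blast
  define L where "L a = (SOME x. E x = a \<and> norm x \<le> 2 * norm (a - u))" for a
  have L: "E (L a) = a \<and> norm (L a) \<le> 2 * norm (a - u)" if "norm (a - u) < \<epsilon>" for a
    unfolding L_def by (rule someI_ex) (use \<epsilon> that in blast)
  have "w \<in> H" for w
  proof -
    have near: "\<exists>s. \<forall>i. s i \<in> products \<Gamma> \<and> norm (real (Suc i) *\<^sub>R a - s i) < D" for a
      by (intro choice allI) (use D(2) in blast)
    obtain s where s: "\<And>i. s i \<in> products \<Gamma>" "\<And>i. norm (real (Suc i) *\<^sub>R u - s i) < D" using near by blast
    obtain q where q: "\<And>i. q i \<in> products \<Gamma>" "\<And>i. norm (real (Suc i) *\<^sub>R w - q i) < D" using near by blast
    have conv: "(\<lambda>i. r i /\<^sub>R real (Suc i)) \<longlonglongrightarrow> a" if r: "\<And>i. norm (real (Suc i) *\<^sub>R a - r i) < D" for r a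
    proof -
      have bound: "\<forall>i. norm (r i /\<^sub>R real (Suc i) - a) \<le> D / real (Suc i)"
      proof
        fix i
        have "r i /\<^sub>R real (Suc i) - a = (1 / real (Suc i)) *\<^sub>R (r i - real (Suc i) *\<^sub>R a)"
          by (simp add: scaleR_diff_right divide_inverse del: of_nat_Suc)
        then have "norm (r i /\<^sub>R real (Suc i) - a) = norm (real (Suc i) *\<^sub>R a - r i) / real (Suc i)"
          by (simp add: norm_minus_commute del: of_nat_Suc)
        then show "norm (r i /\<^sub>R real (Suc i) - a) \<le> D / real (Suc i)"
          using r[of i] by (simp add: divide_right_mono less_imp_le del: of_nat_Suc)
      qed
      have null: "(\<lambda>i. D / real (Suc i)) \<longlonglongrightarrow> 0"
        using tendsto_mult_right_zero[OF LIMSEQ_inverse_real_of_nat, of D]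
        by (simp add: divide_inverse del: of_nat_Suc)
      show ?thesis
        by (rule LIM_zero_cancel, rule Lim_null_comparison[OF always_eventually[OF bound] null])
    qed
    define b where "b i = s i /\<^sub>R real (Suc i)" for i
    have b: "b \<longlonglongrightarrow> u" unfolding b_def by (rule conv) (rule s)
    then have bu: "(\<lambda>i. norm (b i - u)) \<longlonglongrightarrow> 0" by (intro tendsto_norm_zero LIM_zero)
    then have ev: "eventually (\<lambda>i. norm (b i - u) < \<epsilon>) sequentially" by (rule order_tendstoD) (rule \<epsilon>)
    have "(\<lambda>i. L (b i)) \<longlonglongrightarrow> 0"
    proof (rule Lim_null_comparison)
      show "eventually (\<lambda>i. norm (L (b i)) \<le> 2 * norm (b i - u)) sequentially"
        using ev by eventually_elim (use L in blast)
      show "(\<lambda>i. 2 * norm (b i - u)) \<longlonglongrightarrow> 0" using tendsto_mult_right_zero[OF bu] .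
    qed
    then have "(\<lambda>i. E (- L (b i))) \<longlonglongrightarrow> u" 
      using E_tendsto_unit[OF tendsto_minus[of "\<lambda>i. L (b i)" 0, simplified]] by blast
    moreover have "(\<lambda>i. q i /\<^sub>R real (Suc i)) \<longlonglongrightarrow> w" by (rule conv) (rule q)
    ultimately have "(\<lambda>i. q i /\<^sub>R real (Suc i) \<star> E (- L (b i))) \<longlonglongrightarrow> w \<star> u" by (intro m.tendsto)
    then have lim: "(\<lambda>i. q i /\<^sub>R real (Suc i) \<star> E (- L (b i))) \<longlonglongrightarrow> w" by (simp only: unit_right)
    have "eventually (\<lambda>i. q i /\<^sub>R real (Suc i) \<star> E (- L (b i)) \<in> H) sequentially"
      using ev
    proof eventually_elim
      case (elim i)
      define R where "R = real (Suc i)"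
      have R: "R \<noteq> 0" unfolding R_def by simp
      obtain s' where s': "s' \<in> H" "s i \<star> s' = u" using inverse s(1) by blast
      have si: "s i = R *\<^sub>R E (L (b i))"
        using L[OF elim] R unfolding R_def b_def by (simp del: of_nat_Suc)
      have "E (- L (b i)) = E (- L (b i)) \<star> (s i \<star> s')" using s'(2) by (simp add: unit_right)
      also have "\<dots> = R *\<^sub>R (E (- L (b i)) \<star> E (L (b i)) \<star> s')"
        unfolding si by (simp add: m.scaleR_left m.scaleR_right assoc)
      also have "\<dots> = R *\<^sub>R s'" by (simp add: E_minus unit)
      finally have "q i /\<^sub>R R \<star> E (- L (b i)) = q i \<star> s'" using R by (simp add: m.scaleR_left m.scaleR_right)
      then show ?case using q(1)[of i] H_products s'(1) H_mult unfolding R_def by auto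
    qed
    then show "w \<in> H" using Lim_in_closed_set[of H] lim unfolding H_def by force
  qed
  then show ?thesis unfolding H_def by blast
qed

end

section \<open>Orbits of commuting linear maps\<close>

text \<open>A proper subspace misses arbitrarily large balls, as a functional vanishing on it shows.\<close>

lemma coarsely_dense_spans:
  fixes B Y :: "'v::real_normed_vector set"
  assumes B: "finite B" "independent B" "span B = UNIV"
    and D: "\<And>w. \<exists>s\<in>Y. norm (w - s) < D"
  shows "span Y = UNIV"
proof (rule ccontr)
  assume "span Y \<noteq> UNIV"
  then obtain x where "x \<notin> span Y" by blast
  then obtain f :: "'v \<Rightarrow> real" where f: "linear f" "\<And>y. y \<in> span Y \<Longrightarrow> f y = 0" "f x = 1"
    using exists_linear_functional[OF subspace_span] by metis
  obtain F where F: "0 < F" "\<And>y. \<bar>f y\<bar> \<le> norm y * F"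
    using bounded_linear.pos_bounded[OF bounded_linear_finite_dim[OF B f(1)]] by auto
  obtain s where s: "s \<in> Y" "norm ((D * F) *\<^sub>R x - s) < D" using D by blast
  have "f ((D * F) *\<^sub>R x - s) = D * F"
    using f(1) f(2)[OF span_base[OF s(1)]] f(3) by (simp add: linear_diff linear_cmul)
  then have "D * F \<le> norm ((D * F) *\<^sub>R x - s) * F" using F(2)[of "(D * F) *\<^sub>R x - s"] by linarith
  also have "\<dots> < D * F" using s(2) F(1) by (rule mult_strict_right_mono)
  finally show False by simp
qed

lemma linear_semigroup_generated:
  assumes "s \<in> semigroup_generated G" "\<And>g. g \<in> G \<Longrightarrow> linear g"
  shows "linear (s :: 'v::real_vector \<Rightarrow> 'v)"
  using assms(1)
proof induction
  case (generator g)
  then show ?case by (rule assms(2))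
next
  case (comp s t)
  then show ?case using linear_compose by blast
qed

lemma commute_semigroup_generated:
  assumes "s \<in> semigroup_generated G" "\<And>g. g \<in> G \<Longrightarrow> g \<circ> h = h \<circ> g"
  shows "s \<circ> h = h \<circ> s"
  using assms(1)
proof induction
  case (generator g)
  then show ?case by (rule assms(2))
next
  case (comp s t)
  then show ?case by (metis comp_assoc)
qed

text \<open>Since the orbit of \<open>v\<close> spans, an element of the commutative algebra generated by the semigroup is
  determined by its value at \<open>v\<close>, and every vector is such a value. This carries the product over to the
  space, with unit \<open>v\<close>; the product is written down from a basis of orbit points \<open>\<sigma> b v\<close>. The semigroup
  acts by multiplication with the points of its orbit, so that the orbit is the set of products of
  the points \<open>g v\<close>.\<close>

lemma coarsely_dense_orbit_dense_real:
  fixes G :: "('v::real_normed_vector \<Rightarrow> 'v) set"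
  assumes B0: "finite B0" "span B0 = (UNIV :: 'v set)"
    and G: "finite G" "\<And>g. g \<in> G \<Longrightarrow> linear g" "\<And>g. g \<in> G \<Longrightarrow> inj g"
    and comm: "\<And>g h. g \<in> G \<Longrightarrow> h \<in> G \<Longrightarrow> g \<circ> h = h \<circ> g"
    and cd: "coarsely_dense_in (orbit_of (semigroup_generated G) v) UNIV"
  shows "closure (orbit_of (semigroup_generated G) v) = UNIV"
proof -
  define S where "S = semigroup_generated G"
  define Y where "Y = orbit_of S v"
  obtain D where D: "0 < D" "\<And>w. \<exists>s\<in>Y. norm (w - s) < D"
  proof -
    obtain D where D: "0 < D" "UNIV \<subseteq> (\<Union>y\<in>Y. ball y D)"
      using cd unfolding coarsely_dense_in_def D_dense_in_def S_def Y_def by blast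
    have "\<exists>s\<in>Y. norm (w - s) < D" for w
    proof -
      have "w \<in> (\<Union>y\<in>Y. ball y D)" using D(2) by blast
      then show ?thesis by (auto simp: dist_norm norm_minus_commute)
    qed
    then show ?thesis using that D(1) by blast
  qed
  have S_lin: "linear s" if "s \<in> S" for s
    using that G(2) linear_semigroup_generated unfolding S_def by blast
  have S_comm: "s (t x) = t (s x)" if "s \<in> S" "t \<in> S" for s t x
  proof -
    have "s \<circ> h = h \<circ> s" if "h \<in> G" for h
      using \<open>s \<in> S\<close> comm that commute_semigroup_generated unfolding S_def by blast
    then have "t \<circ> s = s \<circ> t"
      using \<open>t \<in> S\<close> commute_semigroup_generated[of t G s] unfolding S_def by metis
    then show ?thesis by (metis comp_apply)
  qed
  obtain B1 where B1: "B1 \<subseteq> B0" "independent B1" "B0 \<subseteq> span B1"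
    by (rule real_vector.maximal_independent_subset)
  have B1': "finite B1" "span B1 = UNIV"
    using finite_subset[OF B1(1) B0(1)] span_minimal[OF B1(3) subspace_span] B0(2) by auto
  have spY: "span Y = UNIV" by (rule coarsely_dense_spans[OF B1'(1) B1(2) B1'(2) D(2)])
  obtain B where B: "B \<subseteq> Y" "independent B" "Y \<subseteq> span B"
    by (rule real_vector.maximal_independent_subset)
  have B': "finite B" "span B = UNIV"
    using real_vector.independent_span_bound[OF B1'(1) B(2)] B1'(2)
      span_minimal[OF B(3) subspace_span] spY by auto
  note Bs = B'(1) B(2) B'(2)
  have "\<forall>b\<in>B. \<exists>s\<in>S. s v = b" using B(1) unfolding Y_def orbit_of_def by blast
  then obtain \<sigma> where \<sigma>: "\<And>b. b \<in> B \<Longrightarrow> \<sigma> b \<in> S" "\<And>b. b \<in> B \<Longrightarrow> \<sigma> b v = b" by metis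
  define mult where "mult x z = (\<Sum>b\<in>B. representation B x b *\<^sub>R \<sigma> b z)" for x z
  have mult_v: "mult x v = x" for x
    unfolding mult_def using \<sigma>(2) Bs by (simp add: real_vector.sum_representation_eq)
  have S_mult: "s (mult x z) = mult x (s z)" if s: "s \<in> S" for s x z
    unfolding mult_def using S_lin[OF s] S_comm[OF s \<sigma>(1)] by (simp add: linear_sum linear_cmul)
  have mult_add_right: "mult x (y + z) = mult x y + mult x z" for x y z
    unfolding mult_def using S_lin[OF \<sigma>(1)] by (simp add: linear_add scaleR_add_right sum.distrib)
  have mult_scaleR_right: "mult x (c *\<^sub>R z) = c *\<^sub>R mult x z" for x c z
    unfolding mult_def using S_lin[OF \<sigma>(1)]
    by (simp add: linear_cmul scaleR_sum_right mult.commute)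
  have mult_lin: "linear (mult x)" for x
    by (rule linearI) (simp_all add: mult_add_right mult_scaleR_right)
  have mult_mult: "mult x (mult y z) = mult y (mult x z)" for x y z
  proof -
    have "mult x (mult y z) = (\<Sum>b\<in>B. representation B x b *\<^sub>R mult y (\<sigma> b z))"
      unfolding mult_def[of x] using S_mult \<sigma>(1) by simp
    also have "\<dots> = mult y (mult x z)"
      unfolding mult_def[of x] using mult_lin by (simp add: linear_sum linear_cmul)
    finally show ?thesis .
  qed
  have mult_comm: "mult x y = mult y x" for x y
    using mult_mult[of x y v] by (simp add: mult_v)
  have mult_assoc: "mult (mult x y) z = mult x (mult y z)" for x y z
    by (metis mult_comm mult_mult)
  have S_is_mult: "s z = mult (s v) z" if s: "s \<in> S" for s z
    using S_mult[OF s, of z v] mult_comm[of z "s v"] by (simp add: mult_v)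
  have bilin: "bounded_bilinear mult"
  proof -
    have "bounded_bilinear (\<lambda>x z. representation B x b *\<^sub>R \<sigma> b z)" if b: "b \<in> B" for b
      by (rule bounded_bilinear.comp[OF bounded_bilinear_scaleR])
        (use b Bs \<sigma>(1) S_lin in \<open>auto intro: bounded_linear_representation bounded_linear_finite_dim\<close>)
    then have "\<forall>b\<in>B. \<exists>k. \<forall>x z. norm (representation B x b *\<^sub>R \<sigma> b z) \<le> norm x * norm z * k"
      using bounded_bilinear.bounded by fast
    from bchoice[OF this] obtain k where
      k: "\<And>b x z. b \<in> B \<Longrightarrow> norm (representation B x b *\<^sub>R \<sigma> b z) \<le> norm x * norm z * k b"
      by blast
    have "norm (mult x z) \<le> norm x * norm z * (\<Sum>b\<in>B. k b)" for x z
      unfolding mult_def sum_distrib_left by (rule sum_norm_le) (rule k)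
    then have bound: "\<exists>k. \<forall>x z. norm (mult x z) \<le> norm x * norm z * k" by blast
    have "mult (x + y) z = mult x z + mult y z" for x y z
      unfolding mult_comm[of _ z] by (rule mult_add_right)
    moreover have "mult (c *\<^sub>R x) z = c *\<^sub>R mult x z" for c x z
      unfolding mult_comm[of _ z] by (rule mult_scaleR_right)
    ultimately show ?thesis
      by (intro bounded_bilinear.intro bound mult_add_right mult_scaleR_right)
  qed
  have v_mult: "mult v x = x" for x using mult_comm[of v x] mult_v by simp
  interpret fd_comm_algebra mult v B
    by (intro fd_comm_algebra.intro bilin mult_assoc mult_comm v_mult Bs)
  define \<Gamma> where "\<Gamma> = (\<lambda>g. g v) ` G"
  have GS: "g \<in> S" if "g \<in> G" for g
    unfolding S_def using that by (rule semigroup_generated.generator)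
  have "s v \<in> products \<Gamma>" if "s \<in> S" for s
    using that unfolding S_def
  proof induction
    case (generator g)
    then show ?case unfolding \<Gamma>_def by (auto intro: products.gen)
  next
    case (comp s t)
    have "(s \<circ> t) v = mult (s v) (t v)" using S_is_mult comp(1) unfolding S_def by simp
    then show ?case using comp by (simp add: products.mul)
  qed
  moreover have "\<exists>s\<in>S. a = s v" if "a \<in> products \<Gamma>" for a
    using that
  proof induction
    case (gen \<gamma>)
    then show ?case unfolding \<Gamma>_def using GS by blast
  next
    case (mul a b)
    then obtain s t where "s \<in> S" "a = s v" "t \<in> S" "b = t v" by blast
    then have "mult a b = (s \<circ> t) v" "s \<circ> t \<in> S"
      using S_is_mult[of s "t v"] unfolding S_def by (auto intro: semigroup_generated.comp)
    then show ?case by blast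
  qed
  ultimately have Y: "Y = products \<Gamma>" unfolding Y_def orbit_of_def by blast
  have "closure (products \<Gamma>) = UNIV"
  proof (rule coarsely_dense_products_dense)
    show "finite \<Gamma>" unfolding \<Gamma>_def using G(1) by simp
    show "w = 0" if \<gamma>: "\<gamma> \<in> \<Gamma>" and w: "mult \<gamma> w = 0" for \<gamma> w
    proof -
      obtain g where g: "g \<in> G" "\<gamma> = g v" using \<gamma> unfolding \<Gamma>_def by blast
      then have "g w = 0" using w S_is_mult[OF GS] by metis
      then show ?thesis using G(2,3)[OF g(1)] linear_injective_0 by blast
    qed
  qed (use D Y in auto)
  then show ?thesis using Y unfolding Y_def S_def by simp
qed

lemma complex_finite_dim_imp_real_spanning:
  fixes smul :: "complex \<Rightarrow> 'w::real_normed_vector \<Rightarrow> 'w"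
  assumes "complex_normed_space smul" "finite_dim smul"
  shows "\<exists>B. finite B \<and> span B = (UNIV :: 'w set)"
proof -
  interpret c: complex_normed_space smul by fact
  obtain B where "finite_dimensional_vector_space smul B" using assms(2) unfolding finite_dim_def by blast
  then interpret f: finite_dimensional_vector_space smul B .
  define B' where "B' = B \<union> smul \<i> ` B"
  have "x \<in> span B'" for x
  proof -
    have "x \<in> c.span B" using f.span_Basis by simp
    then obtain k where x: "x = (\<Sum>b\<in>B. smul (k b) b)" using c.span_finite[OF f.finite_Basis] by auto
    have "smul (k b) b = Re (k b) *\<^sub>R b + Im (k b) *\<^sub>R smul \<i> b" for b
    proof -
      have "smul (k b) b = smul (of_real (Re (k b)) + of_real (Im (k b)) * \<i>) b"
        by (simp add: complex_eq mult.commute)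
      then show ?thesis by (simp add: c.scale_left_distrib c.smul_of_real flip: c.scale_scale)
    qed
    then have "x = (\<Sum>b\<in>B. Re (k b) *\<^sub>R b + Im (k b) *\<^sub>R smul \<i> b)" unfolding x by simp
    also have "\<dots> \<in> span B'"
      by (intro span_sum span_add span_scale span_base) (auto simp: B'_def)
    finally show ?thesis .
  qed
  then have "span B' = UNIV" by blast
  moreover have "finite B'" unfolding B'_def using f.finite_Basis by simp
  ultimately show ?thesis by blast
qed

lemma complex_linear_imp_linear:
  assumes "complex_normed_space smul" "Vector_Spaces.linear smul smul g"
  shows "linear g"
proof -
  interpret c: complex_normed_space smul by fact
  interpret g: Vector_Spaces.linear smul smul g by fact
  show ?thesis
  proof (rule linearI)
    show "g (r *\<^sub>R x) = r *\<^sub>R g x" for r x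
      using g.scale[of "of_real r" x] by (simp add: c.smul_of_real)
  qed (rule g.add)
qed

theorem theorem1p1:
  "(\<forall>(G :: ('v::real_normed_vector \<Rightarrow> 'v) set) S v.
      finite_dim ((*\<^sub>R) :: real \<Rightarrow> 'v \<Rightarrow> 'v) \<longrightarrow>
      finite G \<longrightarrow> G \<subseteq> GL (*\<^sub>R) \<longrightarrow> (\<forall>g\<in>G. \<forall>h\<in>G. g \<circ> h = h \<circ> g) \<longrightarrow>
      S = semigroup_generated G \<longrightarrow>
      coarsely_dense_in (orbit_of S v) UNIV \<longrightarrow> closure (orbit_of S v) = UNIV)
   \<and>
   (\<forall>(smul :: complex \<Rightarrow> 'w::real_normed_vector \<Rightarrow> 'w) (G :: ('w \<Rightarrow> 'w) set) S v.
      complex_normed_space smul \<longrightarrow> finite_dim smul \<longrightarrow>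
      finite G \<longrightarrow> G \<subseteq> GL smul \<longrightarrow> (\<forall>g\<in>G. \<forall>h\<in>G. g \<circ> h = h \<circ> g) \<longrightarrow>
      S = semigroup_generated G \<longrightarrow>
      coarsely_dense_in (orbit_of S v) UNIV \<longrightarrow> closure (orbit_of S v) = UNIV)"
proof (intro conjI allI impI)
  fix G :: "('v \<Rightarrow> 'v) set" and S v
  assume fd: "finite_dim ((*\<^sub>R) :: real \<Rightarrow> 'v \<Rightarrow> 'v)" and G: "finite G" "G \<subseteq> GL (*\<^sub>R)"
    and comm: "\<forall>g\<in>G. \<forall>h\<in>G. g \<circ> h = h \<circ> g" and S: "S = semigroup_generated G"
    and cd: "coarsely_dense_in (orbit_of S v) UNIV"
  obtain B where "finite_dimensional_vector_space ((*\<^sub>R) :: real \<Rightarrow> 'v \<Rightarrow> 'v) B"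
    using fd unfolding finite_dim_def by blast
  then have "finite B" "span B = UNIV"
    unfolding span_raw_def
    by (rule finite_dimensional_vector_space.finite_Basis, rule finite_dimensional_vector_space.span_Basis)
  then show "closure (orbit_of S v) = UNIV"
    unfolding S
  proof (rule coarsely_dense_orbit_dense_real)
    fix g assume "g \<in> G"
    then have "Vector_Spaces.linear (*\<^sub>R) (*\<^sub>R) g" "bij g" using G(2) unfolding GL_def by auto
    then show "linear g" "inj g" by (simp_all only: linear_def bij_is_inj)
  qed (use G(1) comm cd[unfolded S] in blast)+
next
  fix smul :: "complex \<Rightarrow> 'w \<Rightarrow> 'w" and G :: "('w \<Rightarrow> 'w) set" and S v
  assume cns: "complex_normed_space smul" and fd: "finite_dim smul" and G: "finite G" "G \<subseteq> GL smul"
    and comm: "\<forall>g\<in>G. \<forall>h\<in>G. g \<circ> h = h \<circ> g" and S: "S = semigroup_generated G"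
    and cd: "coarsely_dense_in (orbit_of S v) UNIV"
  obtain B where "finite B" "span B = (UNIV :: 'w set)"
    using complex_finite_dim_imp_real_spanning[OF cns fd] by blast
  then show "closure (orbit_of S v) = UNIV"
    unfolding S
  proof (rule coarsely_dense_orbit_dense_real)
    fix g assume "g \<in> G"
    then have "Vector_Spaces.linear smul smul g" "bij g" using G(2) unfolding GL_def by auto
    then show "linear g" "inj g" using complex_linear_imp_linear[OF cns] bij_is_inj by blast+
  qed (use G(1) comm cd[unfolded S] in blast)+
qed

end
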